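(* Suppose that $(x^{*},y^{*})\in X\times Y$ is a saddle-point of $f$, that for every $i\in\mathbf{N}$, $\|K\|\beta_i^2=\frac{1}{\tau_i}-\frac{1}{\tau_{i+1}}$ and $\|K\|(1-\alpha_{i-1})^2=\frac{1}{\sigma_i}-\frac{1}{\sigma_{i+1}}$, and that $\limsup_{i\to\infty}\tau_i<\infty$, $\limsup_{i\to\infty}\sigma_i<\infty$, $\|K\|\limsup_{i\to\infty}\tau_i<\frac12$, and $\|K\|\limsup_{i\to\infty}\sigma_i<\frac12$. Let $((x^k,y^k))_{k\in\mathbf{N}}$ be generated by the iterate scheme in the context, and let $\hat{x}_k=\frac{1}{k+1}\sum_{i=1}^{k+1}x^i$, $\hat{y}_k=\frac{1}{k+1}\sum_{i=1}^{k+1}y^i$. Then the following hold. (i) For every $k\in\mathbf{N}$, $$\frac{1}{2\tau_{k+1}}\|x^{*}-x^{k+1}\|^2+\Big(\frac{1}{2\sigma_{k+1}}-\frac{\|K\|^2\tau_k}{2}\Big)\|y^{*}-y^{k+1}\|^2+\sum_{i=0}^{k-1}\Big(\frac{1}{2\tau_i}-\|K\|\Big)\|x^i-x^{i+1}\|^2+\sum_{i=0}^{k}\Big(\frac{1}{2\sigma_i}-\|K\|\Big)\|y^i-y^{i+1}\|^2\le\frac{1}{2\tau_0}\|x^{*}-x^0\|^2+\frac{1}{2\sigma_0}\|y^{*}-y^0\|^2.$$ (ii) Take $\bar\tau>\limsup_{i\to\infty}\tau_i\ge 0$ and $\bar\sigma>\limsup_{i\to\infty}\sigma_i\ge0$ such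 that $\|K\|\bar\tau<\frac12$ and $\|K\|\bar\sigma<\frac12$. Then there exists $N\in\mathbf{N}$ such that for all $k\in\mathbf{N}$ with $k\ge N+1$, $$\frac{1}{2\bar\tau}\|x^{*}-x^{k+1}\|^2+\Big(\frac{1}{2\bar\sigma}-\frac{\|K\|^2\bar\tau}{2}\Big)\|y^{*}-y^{k+1}\|^2+\Big(\frac{1}{2\bar\tau}-\|K\|\Big)\sum_{i=N+1}^{k-1}\|x^i-x^{i+1}\|^2+\Big(\frac{1}{2\bar\sigma}-\|K\|\Big)\sum_{i=N+1}^{k}\|y^i-y^{i+1}\|^2$$ $$\le\frac{1}{2\tau_0}\|x^{*}-x^0\|^2+\frac{1}{2\sigma_0}\|y^{*}-y^0\|^2+\sum_{i=0}^{N}\Big(\|K\|-\frac{1}{2\tau_i}\Big)\|x^i-x^{i+1}\|^2+\sum_{i=0}^{N}\Big(\|K\|-\frac{1}{2\sigma_i}\Big)\|y^i-y^{i+1}\|^2.$$ Consequently, $\lim_{k\to\infty}\|x^k-x^{k+1}\|=0$ and $\lim_{k\to\infty}\|y^k-y^{k+1}\|=0$. (iii) $((x^k,y^k))_{k\in\mathbf{N}}$ and $((\hat{x}_k,\hat{y}_k))_{k\in\mathbf{N}}$ are bounded. (iv) $f(\hat{x}_k,\hat{y}_k)\to f(x^{*},y^{*})$ as $k\to\infty$.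
   Context: $\mathbf{N}$ is the set of nonnegative integers. $\mathcal{H}_1,\mathcal{H}_2$ are real Hilbert spaces; $X\subseteq\mathcal{H}_1$ and $Y\subseteq\mathcal{H}_2$ are nonempty, closed and convex. $K:\mathcal{H}_1\to\mathcal{H}_2$ is a continuous linear operator with adjoint $K^{*}$ and operator norm $\|K\|$. $g:\mathcal{H}_1\to\mathbf{R}\cup\{+\infty\}$ and $h:\mathcal{H}_2\to\mathbf{R}\cup\{+\infty\}$ are proper, convex and lower semicontinuous, and $f(x,y)=\langle Kx,y\rangle+g(x)-h(y)$ for $(x,y)\in X\times Y$. Standing assumption: for every $y\in Y$, $f(\cdot,y)$ maps $X$ into $\mathbf{R}\cup\{+\infty\}$ and is proper; for every $x\in X$, $f(x,\cdot)$ maps $Y$ into $\mathbf{R}\cup\{-\infty\}$ and is proper (thus $g$ is finite on $X$, $h$ is finite on $Y$, and $f$ is real-valued on $X\times Y$). A saddle-point of $f$ is $(x^{*},y^{*})\in X\times Y$ with $f(x^{*},y)\le f(x^{*},y^{*})\le f(x,y^{*})$ for all $x\in X$, $y\in Y$. Parameters: $(\tau_k)_{k\in\mathbf{N}},(\sigma_k)_{k\in\mathbf{N}}$ are sequences of positive reals and $(\alpha_k)_{k\in\mathbf{N}\cup\{-1\}},(\beta_k)_{k\in\mathbf{N}\cup\{-1\}}$ are sequences of nonnegative reals. Iterate scheme: for a nonempty closed convex set $C$ and a function $\varphi$, $\operatorname{Prox}^{C}_{\varphi}(v):=\operatorname{argmin}_{u\in C}\{\varphi(u)+\frac12\|u-v\|^2\}$.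 Given $(x^0,y^0)\in X\times Y$, set $\bar{x}^0=x^0$, $\bar{y}^0=y^0$, $x^{-1}=x^0$, $y^{-1}=y^0$, and for every $k\in\mathbf{N}$: $y^{k+1}=\operatorname{Prox}^{Y}_{\sigma_k h}(y^k+\sigma_kK\bar{x}^k)$; $\bar{y}^{k+1}=y^{k+1}+\beta_k(y^{k+1}-y^k)$; $x^{k+1}=\operatorname{Prox}^{X}_{\tau_k g}(x^k-\tau_kK^{*}\bar{y}^{k+1})$; $\bar{x}^{k+1}=x^{k+1}+\alpha_k(x^{k+1}-x^k)$. Empty sums are $0$. *)

theory Defs
  imports "HOL-Analysis.Analysis"
begin

definition proper_on :: "'a set \<Rightarrow> ('a \<Rightarrow> ereal) \<Rightarrow> bool" where
  "proper_on S \<phi> \<longleftrightarrow> (\<forall>x\<in>S. \<phi> x \<noteq> -\<infinity>) \<and> (\<exists>x\<in>S. \<phi> x \<noteq> \<infinity>)"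

text \<open>Convexity is only used for functions that never take the value \<open>-\<infinity>\<close>, so no
  undefined sum \<open>\<infinity> - \<infinity>\<close> can occur on the right-hand side.\<close>

definition convex_ereal :: "('a::real_vector \<Rightarrow> ereal) \<Rightarrow> bool" where
  "convex_ereal \<phi> \<longleftrightarrow>
     (\<forall>x y. \<forall>t::real. 0 < t \<and> t < 1 \<longrightarrow>
        \<phi> ((1 - t) *\<^sub>R x + t *\<^sub>R y) \<le> ereal (1 - t) * \<phi> x + ereal t * \<phi> y)"

definition lsc :: "('a::topological_space \<Rightarrow> ereal) \<Rightarrow> bool" where
  "lsc \<phi> \<longleftrightarrow> (\<forall>x. \<phi> x \<le> Liminf (at x) \<phi>)"

text \<open>The value at \<open>g x = h y = \<infinity>\<close>, where the difference is an artefact of \<^typ>\<open>ereal\<close>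
  arithmetic, is irrelevant: such pairs are excluded on \<open>X \<times> Y\<close> by the properness of
  the sections of this function.\<close>

definition bilinear_saddle ::
  "('a::real_inner \<Rightarrow> 'b::real_inner) \<Rightarrow> ('a \<Rightarrow> ereal) \<Rightarrow> ('b \<Rightarrow> ereal) \<Rightarrow> 'a \<Rightarrow> 'b \<Rightarrow> ereal" where
  "bilinear_saddle K g h x y = ereal (K x \<bullet> y) + g x - h y"

definition saddle_point :: "'a set \<Rightarrow> 'b set \<Rightarrow> ('a \<Rightarrow> 'b \<Rightarrow> ereal) \<Rightarrow> 'a \<Rightarrow> 'b \<Rightarrow> bool" where
  "saddle_point X Y f xs ys \<longleftrightarrow>
     xs \<in> X \<and> ys \<in> Y \<and> (\<forall>x\<in>X. \<forall>y\<in>Y. f xs y \<le> f xs ys \<and> f xs ys \<le> f x ys)"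

definition prox :: "'a::real_inner set \<Rightarrow> ('a \<Rightarrow> ereal) \<Rightarrow> 'a \<Rightarrow> 'a" where
  "prox C \<phi> v = arg_min_on (\<lambda>u. \<phi> u + ereal ((norm (u - v))\<^sup>2 / 2)) C"

text \<open>The parameters \<open>\<alpha>\<close> and \<open>\<beta>\<close> are indexed by integers because they start at index \<open>-1\<close>;
  their values below \<open>-1\<close> are never used. The sequences \<open>xb\<close>, \<open>yb\<close> are the extrapolated
  points.\<close>

definition iterate_scheme ::
  "('a::real_inner \<Rightarrow> 'b::real_inner) \<Rightarrow> ('a \<Rightarrow> ereal) \<Rightarrow> ('b \<Rightarrow> ereal) \<Rightarrow> 'a set \<Rightarrow> 'b set \<Rightarrow>
   (nat \<Rightarrow> real) \<Rightarrow> (nat \<Rightarrow> real) \<Rightarrow> (int \<Rightarrow> real) \<Rightarrow> (int \<Rightarrow> real) \<Rightarrow>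
   (nat \<Rightarrow> 'a) \<Rightarrow> (nat \<Rightarrow> 'b) \<Rightarrow> (nat \<Rightarrow> 'a) \<Rightarrow> (nat \<Rightarrow> 'b) \<Rightarrow> bool" where
  "iterate_scheme K g h X Y \<tau> \<sigma> \<alpha> \<beta> x y xb yb \<longleftrightarrow>
     x 0 \<in> X \<and> y 0 \<in> Y \<and> xb 0 = x 0 \<and> yb 0 = y 0 \<and>
     (\<forall>k. y (Suc k) = prox Y (\<lambda>u. ereal (\<sigma> k) * h u) (y k + \<sigma> k *\<^sub>R K (xb k)) \<and>
          yb (Suc k) = y (Suc k) + \<beta> (int k) *\<^sub>R (y (Suc k) - y k) \<and>
          x (Suc k) = prox X (\<lambda>u. ereal (\<tau> k) * g u) (x k - \<tau> k *\<^sub>R adjoint K (yb (Suc k))) \<and>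
          xb (Suc k) = x (Suc k) + \<alpha> (int k) *\<^sub>R (x (Suc k) - x k))"

definition ergodic_mean :: "(nat \<Rightarrow> 'a::real_vector) \<Rightarrow> nat \<Rightarrow> 'a" where
  "ergodic_mean x k = (1 / real (k + 1)) *\<^sub>R (\<Sum>i=1..k+1. x i)"

end

theory Submission
  imports Defs
begin

text \<open>
  Write \<open>\<Phi>\<close> for the real-valued restriction of \<open>f\<close> to \<open>X \<times> Y\<close>, \<open>L\<close> for the operator norm
  of \<open>K\<close>, and \<open>p\<^sub>k = x\<^sub>k\<^sub>+\<^sub>1 - x\<^sub>k\<close>, \<open>q\<^sub>k = y\<^sub>k\<^sub>+\<^sub>1 - y\<^sub>k\<close> for the increments.

  A proximal point minimizes a strongly convex function, so that function exceeds its minimum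
  at \<open>z\<close> by at least half the squared distance from \<open>z\<close> to the minimizer. Adding this
  three-point inequality for \<open>x\<^sub>k\<^sub>+\<^sub>1\<close> (tested at \<open>z\<close>) and for \<open>y\<^sub>k\<^sub>+\<^sub>1\<close> (tested at \<open>w\<close>) bounds
  the gap \<open>\<Phi> x\<^sub>k\<^sub>+\<^sub>1 w - \<Phi> z y\<^sub>k\<^sub>+\<^sub>1\<close> by differences of squared distances plus terms containing
  \<open>K\<close>. Those terms (lemma \<open>cross_terms\<close>) consist of a telescoping difference of
  \<open>K p\<^sub>k \<bullet> (w - y\<^sub>k\<^sub>+\<^sub>1)\<close>, the product \<open>K p\<^sub>k\<^sub>-\<^sub>1 \<bullet> q\<^sub>k\<close>, and two errors carrying the factors
  \<open>1 - \<alpha>\<^sub>k\<^sub>-\<^sub>1\<close> and \<open>\<beta>\<^sub>k\<close>. Up to multiples of the squared increments, the Young inequality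
  bounds the errors by \<open>L (1 - \<alpha>\<^sub>k\<^sub>-\<^sub>1)\<^sup>2 / 2\<close> times the
  squared distance from \<open>w\<close> to \<open>y\<^sub>k\<^sub>+\<^sub>1\<close> and \<open>L \<beta>\<^sub>k\<^sup>2 / 2\<close> times that from \<open>z\<close> to \<open>x\<^sub>k\<^sub>+\<^sub>1\<close>, and
  the step-size recursions say that exactly these amounts turn the weights \<open>1 / (2 \<sigma>\<^sub>k)\<close>, \<open>1 / (2 \<tau>\<^sub>k)\<close>
  into \<open>1 / (2 \<sigma>\<^sub>k\<^sub>+\<^sub>1)\<close>, \<open>1 / (2 \<tau>\<^sub>k\<^sub>+\<^sub>1)\<close>. Hence everything telescopes (\<open>gap_step\<close>, \<open>gap_sum_bound\<close>).

  At a saddle point the gaps are nonnegative, which gives the energy inequality. The same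
  recursions make both step sizes nondecreasing, so each is at most its limit superior; when
  \<open>T\<close>, \<open>S\<close> are upper bounds with \<open>L T < 1/2\<close> and \<open>L S < 1/2\<close>, all coefficients are bounded below
  by positive constants. So the iterates are bounded and their increments are square-summable.
  For arbitrary \<open>(z, w)\<close> the gap sum is therefore at most a quadratic in \<open>(z, w)\<close> independent of
  \<open>k\<close>, and Jensen's inequality makes the gap at the ergodic means \<open>O(1/k)\<close>
  (\<open>ergodic_gap_rate\<close>). Testing it at \<open>(x\<^sup>*, mean of y)\<close> and at \<open>(mean of x, y\<^sup>*)\<close> squeezes the
  value of \<open>\<Phi>\<close> at the means to its saddle value.

  Two existence questions are settled on the way. The proximal points exist because the saddle
  point itself supplies affine minorants of \<open>g\<close> on \<open>X\<close> and of \<open>h\<close> on \<open>Y\<close>, so the regularized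
  objectives are bounded below and a minimizing sequence is Cauchy. The adjoint of \<open>K\<close> exists
  by the Riesz representation theorem, which is the special case of a proximal point of minus a
  linear functional at the origin.
\<close>

section \<open>Proximal points\<close>

text \<open>The punctured neighbourhoods in the definition of \<open>lsc\<close> can be replaced by full ones, since
  \<open>a - e\<close> lies strictly below the value at \<open>u\<close> itself.\<close>

lemma lsc_eventually_greater:
  fixes \<phi> :: "'a::metric_space \<Rightarrow> ereal"
  assumes lsc: "lsc \<phi>" and fin: "\<phi> u = ereal a" and lim: "w \<longlonglongrightarrow> u" and e: "0 < e"
  shows "\<forall>\<^sub>F n in sequentially. ereal (a - e) < \<phi> (w n)"
proof -
  have "\<forall>y<\<phi> u. \<forall>\<^sub>F x in at u. y < \<phi> x"
    using lsc unfolding lsc_def le_Liminf_iff by blast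
  then have "\<forall>\<^sub>F x in at u. ereal (a - e) < \<phi> x"
    using fin e by simp
  moreover have "ereal (a - e) < \<phi> u"
    using fin e by simp
  ultimately have "\<forall>\<^sub>F x in nhds u. ereal (a - e) < \<phi> x"
    using eventually_nhds_conv_at by blast
  then show ?thesis
    using lim by (rule eventually_compose_filterlim)
qed

text \<open>The midpoint inequality with the extra term \<open>- (norm (u - w))\<^sup>2 / 8\<close> is strong convexity with
  modulus one. Applied to two almost-minimizers, whose midpoint cannot lie below the infimum, it
  forces them close together, so a minimizing sequence is Cauchy.\<close>

lemma strongly_convex_minimizer:
  fixes F :: "'a::{real_inner, complete_space} \<Rightarrow> real"
  assumes C: "C \<noteq> {}" "closed C" "convex C"
    and bdd: "\<And>u. u \<in> C \<Longrightarrow> m0 \<le> F u"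
    and mid: "\<And>u w. u \<in> C \<Longrightarrow> w \<in> C \<Longrightarrow>
      F ((1/2) *\<^sub>R u + (1/2) *\<^sub>R w) \<le> (F u + F w) / 2 - (norm (u - w))\<^sup>2 / 8"
    and lsc: "\<And>u w e. u \<in> C \<Longrightarrow> (\<And>n. w n \<in> C) \<Longrightarrow> w \<longlonglongrightarrow> u \<Longrightarrow> 0 < e \<Longrightarrow>
      \<forall>\<^sub>F n in sequentially. F u - e < F (w n)"
  obtains p where "p \<in> C" "\<And>z. z \<in> C \<Longrightarrow> F p \<le> F z"
proof -
  define m where "m = (INF u\<in>C. F u)"
  have bb: "bdd_below (F ` C)" using bdd by (auto intro!: bdd_belowI)
  have m: "m \<le> F u" if "u \<in> C" for u
    unfolding m_def using bb that by (rule cINF_lower)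
  have "\<exists>u\<in>C. F u < m + 1 / real (Suc n)" for n
  proof -
    have "m < m + 1 / real (Suc n)" by simp
    then show ?thesis unfolding m_def using C(1) bb by (subst (asm) cINF_less_iff) auto
  qed
  then obtain w where wC: "\<And>n. w n \<in> C" and w: "\<And>n. F (w n) < m + 1 / real (Suc n)"
    by metis
  have close: "(norm (a - b))\<^sup>2 \<le> 4 * (F a - m + (F b - m))" if "a \<in> C" "b \<in> C" for a b
  proof -
    have "(1/2) *\<^sub>R a + (1/2) *\<^sub>R b \<in> C"
      using convexD[OF C(3) that, of "1/2" "1/2"] by simp
    from m[OF this] mid[OF that] show ?thesis by argo
  qed
  have "Cauchy w"
  proof (rule metric_CauchyI)
    fix e :: real assume e: "0 < e"
    \<comment> \<open>Two points within \<open>e\<^sup>2 / 8\<close> of the infimum are closer than \<open>e\<close>, by \<open>close\<close>.\<close>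
    obtain M :: nat where M: "8 / e\<^sup>2 < real M" using reals_Archimedean2 by blast
    have small: "1 / real (Suc n) < e\<^sup>2 / 8" if "n \<ge> M" for n
    proof -
      have "8 / e\<^sup>2 < real (Suc n)" using M that by linarith
      then show ?thesis using e by (simp add: field_simps)
    qed
    show "\<exists>M. \<forall>m\<ge>M. \<forall>n\<ge>M. dist (w m) (w n) < e"
    proof (intro exI allI impI)
      fix i j assume ij: "M \<le> i" "M \<le> j"
      have "(norm (w i - w j))\<^sup>2 < e\<^sup>2"
        using close[OF wC[of i] wC[of j]] w[of i] w[of j] small[OF ij(1)] small[OF ij(2)] by argo
      then show "dist (w i) (w j) < e"
        unfolding dist_norm by (rule power_less_imp_less_base) (use e in simp)
    qed
  qed
  then obtain p where lim: "w \<longlonglongrightarrow> p" using Cauchy_convergent convergent_def by blast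
  have pC: "p \<in> C" using closed_sequentially[OF C(2)] wC lim by blast
  have "F p \<le> m + e" if e: "0 < e" for e
  proof -
    have "\<forall>\<^sub>F n in sequentially. 1 / real (Suc n) < e / 2"
      using order_tendstoD(2)[OF LIMSEQ_inverse_real_of_nat, of "e/2"] e by (simp add: inverse_eq_divide)
    with lsc[OF pC wC lim, of "e/2"] e
    have "\<forall>\<^sub>F n in sequentially. F p - e/2 < F (w n) \<and> 1 / real (Suc n) < e / 2"
      by (auto elim: eventually_conj)
    then obtain n where "F p - e/2 < F (w n)" "1 / real (Suc n) < e / 2"
      using eventually_happens'[OF sequentially_bot] by blast
    with w[of n] show ?thesis by linarith
  qed
  then have "F p \<le> m" by (rule field_le_epsilon)
  with m pC that show thesis by (meson order_trans)
qed

text \<open>Comparing \<open>p\<close> with the point \<open>(1 - t) p + t z\<close>, where the quadratic gains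
  \<open>t (1 - t) / 2\<close> times the squared distance from \<open>p\<close> to \<open>z\<close>, and dividing by \<open>t\<close> gives the
  claim up to a factor \<open>1 - t\<close>; then let \<open>t\<close> tend to zero.\<close>

lemma quadratic_growth_at_prox:
  fixes G :: "'a::real_inner \<Rightarrow> real"
  assumes G: "convex_on C G" and pC: "p \<in> C"
    and min: "\<And>z. z \<in> C \<Longrightarrow> G p + (norm (p - v))\<^sup>2 / 2 \<le> G z + (norm (z - v))\<^sup>2 / 2"
    and z: "z \<in> C"
  shows "G p + (norm (p - v))\<^sup>2 / 2 + (norm (z - p))\<^sup>2 / 2 \<le> G z + (norm (z - v))\<^sup>2 / 2"
proof -
  define r where "r = (norm (z - p))\<^sup>2 / 2"
  define D where "D = G z + (norm (z - v))\<^sup>2 / 2 - G p - (norm (p - v))\<^sup>2 / 2"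
  have key: "(1 - t) * r \<le> D" if t: "0 < t" "t < 1" for t
  proof -
    let ?q = "(1 - t) *\<^sub>R p + t *\<^sub>R z"
    have "?q \<in> C" using G pC z t unfolding convex_on_def convex_def by simp
    from min[OF this]
    have "G p + (norm (p - v))\<^sup>2 / 2 \<le> G ?q + (norm (?q - v))\<^sup>2 / 2" .
    also have "\<dots> \<le> ((1 - t) * G p + t * G z) + (norm (?q - v))\<^sup>2 / 2"
      using convex_onD[OF G, of t p z] t pC z by simp
    also have "(norm (?q - v))\<^sup>2 / 2
        = (1 - t) * ((norm (p - v))\<^sup>2 / 2) + t * ((norm (z - v))\<^sup>2 / 2) - t * (1 - t) * r"
      unfolding r_def power2_norm_eq_inner
      by (simp add: inner_simps inner_commute algebra_simps) (simp add: field_simps)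
    finally have "t * ((1 - t) * r) \<le> t * D"
      unfolding D_def by argo
    then show ?thesis using t by simp
  qed
  have "((\<lambda>t. (1 - t) * r) \<longlongrightarrow> (1 - 0) * r) (at_right 0)"
    by (intro tendsto_intros)
  moreover have "\<forall>\<^sub>F t in at_right 0. (1 - t) * r \<le> D"
    using key eventually_at_right_less[of "0::real"] by (auto simp: eventually_at_right_field intro: exI[of _ 1])
  ultimately have "(1 - 0) * r \<le> D"
    by (rule tendsto_upperbound) simp
  then show ?thesis unfolding r_def D_def by simp
qed

text \<open>The affine minorant bounds the regularized objective below: a linear term loses against the
  quadratic by completing the square. It thus ensures that \<open>prox\<close>, a choice among minimizers, is
  really one of them.\<close>

lemma prox_characterization:
  fixes \<phi> :: "'a::{real_inner, complete_space} \<Rightarrow> ereal"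
  assumes C: "C \<noteq> {}" "closed C" "convex C"
    and fin: "\<And>u. u \<in> C \<Longrightarrow> \<phi> u = ereal (G u)"
    and G: "convex_on C G" and lsc: "lsc \<phi>"
    and l: "bounded_linear l" and minorant: "\<And>u. u \<in> C \<Longrightarrow> c + l u \<le> G u"
  shows "prox C \<phi> v \<in> C" and "z \<in> C \<Longrightarrow>
    G (prox C \<phi> v) + (norm (prox C \<phi> v - v))\<^sup>2 / 2 + (norm (z - prox C \<phi> v))\<^sup>2 / 2
      \<le> G z + (norm (z - v))\<^sup>2 / 2"
proof -
  define F where "F u = G u + (norm (u - v))\<^sup>2 / 2" for u
  obtain p where pC: "p \<in> C" and p: "\<And>z. z \<in> C \<Longrightarrow> F p \<le> F z"
  proof (rule strongly_convex_minimizer[OF C])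
    fix u assume u: "u \<in> C"
    have "- (l (u - v)) \<le> onorm l * norm (u - v)"
      using onorm[OF l, of "u - v"] by simp
    moreover have "l (u - v) = l u - l v"
      using l by (simp add: bounded_linear.linear linear_diff)
    moreover have "onorm l * norm (u - v) \<le> (onorm l)\<^sup>2 / 2 + (norm (u - v))\<^sup>2 / 2"
      using sum_squares_bound[of "onorm l" "norm (u - v)"] by simp
    ultimately show "c + l v - (onorm l)\<^sup>2 / 2 \<le> F u"
      using minorant[OF u] unfolding F_def by linarith
  next
    fix u w assume uw: "u \<in> C" "w \<in> C"
    have "G ((1/2) *\<^sub>R u + (1/2) *\<^sub>R w) \<le> (G u + G w) / 2"
      using convex_onD[OF G, of "1/2" u w] uw by simp
    moreover have "(norm ((1/2) *\<^sub>R u + (1/2) *\<^sub>R w - v))\<^sup>2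
        = ((norm (u - v))\<^sup>2 + (norm (w - v))\<^sup>2) / 2 - (norm (u - w))\<^sup>2 / 4"
      unfolding power2_norm_eq_inner
      by (simp add: inner_simps inner_commute) (simp add: field_simps)
    ultimately show "F ((1/2) *\<^sub>R u + (1/2) *\<^sub>R w) \<le> (F u + F w) / 2 - (norm (u - w))\<^sup>2 / 8"
      unfolding F_def by (simp add: field_simps)
  next
    fix u w and e :: real
    assume u: "u \<in> C" and w: "\<And>n. w n \<in> C" and lim: "w \<longlonglongrightarrow> u" and e: "0 < e"
    have "\<forall>\<^sub>F n in sequentially. G u - e/2 < G (w n)"
      using lsc_eventually_greater[OF lsc fin[OF u] lim, of "e/2"] e fin w by simp
    moreover have "(\<lambda>n. (norm (w n - v))\<^sup>2 / 2) \<longlonglongrightarrow> (norm (u - v))\<^sup>2 / 2"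
      by (intro tendsto_intros lim) simp
    then have "\<forall>\<^sub>F n in sequentially. (norm (u - v))\<^sup>2 / 2 - e/2 < (norm (w n - v))\<^sup>2 / 2"
      by (rule order_tendstoD(1)) (use e in simp)
    ultimately show "\<forall>\<^sub>F n in sequentially. F u - e < F (w n)"
      unfolding F_def by eventually_elim linarith
  qed blast
  have obj: "\<phi> u + ereal ((norm (u - v))\<^sup>2 / 2) = ereal (F u)" if "u \<in> C" for u
    using fin[OF that] unfolding F_def by simp
  have *: "prox C \<phi> v \<in> C \<and> (\<forall>z\<in>C. F (prox C \<phi> v) \<le> F z)"
    unfolding prox_def arg_min_on_def
  proof (rule arg_minI)
    show "p \<in> C" by (rule pC)
  next
    fix y assume "y \<in> C"
    then show "\<not> \<phi> y + ereal ((norm (y - v))\<^sup>2 / 2) < \<phi> p + ereal ((norm (p - v))\<^sup>2 / 2)"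
      using p pC by (simp add: obj not_less)
  next
    fix q assume q: "q \<in> C" "\<forall>y. y \<in> C \<longrightarrow>
      \<not> \<phi> y + ereal ((norm (y - v))\<^sup>2 / 2) < \<phi> q + ereal ((norm (q - v))\<^sup>2 / 2)"
    then have "\<forall>z\<in>C. \<not> ereal (F z) < ereal (F q)" using obj by metis
    then show "q \<in> C \<and> (\<forall>z\<in>C. F q \<le> F z)" using q(1) by (simp add: not_less)
  qed
  then show "prox C \<phi> v \<in> C" by blast
  then show "G (prox C \<phi> v) + (norm (prox C \<phi> v - v))\<^sup>2 / 2 + (norm (z - prox C \<phi> v))\<^sup>2 / 2
      \<le> G z + (norm (z - v))\<^sup>2 / 2" if "z \<in> C"
    by (rule quadratic_growth_at_prox[OF G]) (use * that in \<open>auto simp: F_def\<close>)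
qed

lemma convex_on_real_part:
  assumes "convex_ereal \<phi>" and C: "convex C" and fin: "\<And>u. u \<in> C \<Longrightarrow> \<phi> u = ereal (G u)"
  shows "convex_on C G"
proof (rule convex_onI[OF _ C])
  fix t u w assume *: "(0::real) < t" "t < 1" "u \<in> C" "w \<in> C"
  then have in_C: "(1 - t) *\<^sub>R u + t *\<^sub>R w \<in> C" using C by (simp add: convex_def)
  have "\<phi> ((1 - t) *\<^sub>R u + t *\<^sub>R w) \<le> ereal (1 - t) * \<phi> u + ereal t * \<phi> w"
    using assms(1) * unfolding convex_ereal_def by blast
  then show "G ((1 - t) *\<^sub>R u + t *\<^sub>R w) \<le> (1 - t) * G u + t * G w"
    using fin[OF in_C] fin[OF *(3)] fin[OF *(4)] by simp
qed

lemma lsc_cmult: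
  assumes "lsc \<phi>" and t: "0 < t"
  shows "lsc (\<lambda>u. ereal t * \<phi> u)"
  unfolding lsc_def le_Liminf_iff
proof (intro allI impI)
  fix u y assume "y < ereal t * \<phi> u"
  then have "y / ereal t < \<phi> u"
    using t by (simp add: ereal_divide_less_pos mult.commute)
  then have "\<forall>\<^sub>F w in at u. y / ereal t < \<phi> w"
    using assms(1) unfolding lsc_def le_Liminf_iff by blast
  then show "\<forall>\<^sub>F w in at u. y < ereal t * \<phi> w"
    by eventually_elim (use t in \<open>simp add: ereal_divide_less_pos mult.commute\<close>)
qed

text \<open>The three-point inequality in the form used by one step of the scheme: \<open>v\<close> is the current
  iterate and \<open>d\<close> the direction in which the bilinear coupling moves it before the proximal map.
  The contribution of \<open>d\<close> is separated from the squared distances.\<close>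

lemma prox_step:
  fixes \<phi> :: "'a::{real_inner, complete_space} \<Rightarrow> ereal"
  assumes C: "C \<noteq> {}" "closed C" "convex C"
    and fin: "\<And>u. u \<in> C \<Longrightarrow> \<phi> u = ereal (G u)"
    and \<phi>: "convex_ereal \<phi>" "lsc \<phi>"
    and l: "bounded_linear l" and minorant: "\<And>u. u \<in> C \<Longrightarrow> c + l u \<le> G u"
    and t: "0 < t" and p: "p = prox C (\<lambda>u. ereal t * \<phi> u) (v + t *\<^sub>R d)"
  shows "p \<in> C" and "z \<in> C \<Longrightarrow> G p - G z \<le>
    1 / (2 * t) * ((norm (z - v))\<^sup>2 - (norm (v - p))\<^sup>2 - (norm (z - p))\<^sup>2) - (z - p) \<bullet> d"
proof -
  have fin': "ereal t * \<phi> u = ereal (t * G u)" if "u \<in> C" for u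
    using fin[OF that] by simp
  have conv: "convex_on C (\<lambda>u. t * G u)"
    using convex_on_real_part[OF \<phi>(1) C(3) fin] t by (intro convex_on_cmul) auto
  have l': "bounded_linear (\<lambda>u. t * l u)" by (rule bounded_linear_mult_right[THEN bounded_linear_compose, OF l])
  have minorant': "t * c + t * l u \<le> t * G u" if "u \<in> C" for u
    using mult_left_mono[OF minorant[OF that], of t] t by (simp add: distrib_left)
  show "p \<in> C"
    unfolding p by (rule prox_characterization(1)[OF C fin' conv lsc_cmult[OF \<phi>(2) t] l' minorant'])
  have growth: "t * G p + (norm (p - (v + t *\<^sub>R d)))\<^sup>2 / 2 + (norm (z - p))\<^sup>2 / 2
      \<le> t * G z + (norm (z - (v + t *\<^sub>R d)))\<^sup>2 / 2" if "z \<in> C"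
    unfolding p
    by (rule prox_characterization(2)[OF C fin' conv lsc_cmult[OF \<phi>(2) t] l' minorant' that])
  show "G p - G z \<le>
    1 / (2 * t) * ((norm (z - v))\<^sup>2 - (norm (v - p))\<^sup>2 - (norm (z - p))\<^sup>2) - (z - p) \<bullet> d"
    if z: "z \<in> C"
  proof -
    have "(norm (z - (v + t *\<^sub>R d)))\<^sup>2 - (norm (p - (v + t *\<^sub>R d)))\<^sup>2
        = (norm (z - v))\<^sup>2 - (norm (v - p))\<^sup>2 - 2 * t * ((z - p) \<bullet> d)"
      unfolding power2_norm_eq_inner by (simp add: inner_simps inner_commute algebra_simps)
    with growth[OF z]
    have "t * (G p - G z) \<le> ((norm (z - v))\<^sup>2 - (norm (v - p))\<^sup>2 - (norm (z - p))\<^sup>2) / 2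
        - t * ((z - p) \<bullet> d)" unfolding right_diff_distrib[of t] by argo
    then have "G p - G z \<le> (((norm (z - v))\<^sup>2 - (norm (v - p))\<^sup>2 - (norm (z - p))\<^sup>2) / 2
        - t * ((z - p) \<bullet> d)) / t"
      using t by (simp add: pos_le_divide_eq mult.commute)
    then show ?thesis using t by (simp add: diff_divide_distrib)
  qed
qed

section \<open>Riesz representation and the adjoint\<close>

text \<open>The representing vector is the minimizer \<open>p\<close> of \<open>(norm u)\<^sup>2 / 2 - l u\<close>. Quadratic growth at \<open>p\<close>
  says that \<open>l (z - p) \<le> (z - p) \<bullet> p\<close> for all \<open>z\<close>; as \<open>z - p\<close> is arbitrary and may be replaced
  by its negative, equality holds.\<close>

lemma riesz_representation:
  fixes l :: "'a::{real_inner, complete_space} \<Rightarrow> real"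
  assumes l: "bounded_linear l"
  obtains p where "\<And>u. l u = u \<bullet> p"
proof -
  interpret bounded_linear l by (rule l)
  define p where "p = prox UNIV (\<lambda>u. ereal (- l u)) 0"
  have conv: "convex_on UNIV (\<lambda>u. - l u)"
    by (rule convex_onI) (auto simp: add scaleR)
  have lsc: "lsc (\<lambda>u. ereal (- l u))"
    unfolding lsc_def
  proof
    fix u
    have "((\<lambda>u. ereal (- l u)) \<longlongrightarrow> ereal (- l u)) (at u)"
      by (intro tendsto_intros tendsto)
    then show "ereal (- l u) \<le> Liminf (at u) (\<lambda>u. ereal (- l u))"
      by (cases "at u = bot") (simp_all add: lim_imp_Liminf del: lim_ereal)
  qed
  have upper: "l (z - p) \<le> (z - p) \<bullet> p" for z
  proof -
    have "- l p + (norm p)\<^sup>2 / 2 + (norm (z - p))\<^sup>2 / 2 \<le> - l z + (norm z)\<^sup>2 / 2"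
      using prox_characterization(2)[of UNIV "\<lambda>u. ereal (- l u)" "\<lambda>u. - l u" "\<lambda>u. - l u" 0 z 0]
        conv lsc bounded_linear_minus[OF l] by (simp add: p_def)
    then show ?thesis
      unfolding power2_norm_eq_inner by (simp add: diff inner_diff inner_commute) argo
  qed
  have le: "l u \<le> u \<bullet> p" for u
    using upper[of "p + u"] by simp
  have "l u = u \<bullet> p" for u
    using le[of u] le[of "- u"] by (simp add: neg)
  with that show thesis .
qed

text \<open>In a Hilbert space the choice in the definition of \<open>adjoint\<close> has a witness, by the Riesz
  representation of \<open>u \<mapsto> K u \<bullet> v\<close>.\<close>

lemma adjoint_inner:
  fixes K :: "'a::{real_inner, complete_space} \<Rightarrow> 'b::real_inner"
  assumes K: "bounded_linear K"
  shows "K u \<bullet> v = u \<bullet> adjoint K v"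
proof -
  have "\<exists>p. \<forall>u. K u \<bullet> v = u \<bullet> p" for v
    using riesz_representation[OF bounded_linear_compose[OF bounded_linear_inner_left K]] by metis
  then have "\<exists>A. \<forall>u v. K u \<bullet> v = u \<bullet> A v" by metis
  then have "\<forall>u v. K u \<bullet> v = u \<bullet> adjoint K v"
    unfolding adjoint_def by (rule someI_ex)
  then show ?thesis by blast
qed

section \<open>Sequences and ergodic means\<close>

text \<open>The index is shifted to start at zero, the form in which the gap sums appear.\<close>

lemma ergodic_mean_as_convex_combination:
  "ergodic_mean s k = (\<Sum>i<Suc k. (1 / real (Suc k)) *\<^sub>R s (Suc i))"
proof -
  have "(\<Sum>i = 1..k + 1. s i) = (\<Sum>i<Suc k. s (Suc i))"
    by (rule sum.reindex_bij_witness[of _ Suc "\<lambda>i. i - 1"]) auto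
  then show ?thesis unfolding ergodic_mean_def by (simp only: scaleR_sum_right Suc_eq_plus1)
qed

lemma ergodic_mean_in_convex:
  assumes "convex S" and "\<And>i. s i \<in> S"
  shows "ergodic_mean s k \<in> S"
  unfolding ergodic_mean_as_convex_combination
  by (rule convex_sum) (use assms in auto)

lemma ergodic_mean_Jensen:
  assumes F: "convex_on S F" and s: "\<And>i. s i \<in> S"
  shows "F (ergodic_mean s k) \<le> (\<Sum>i<Suc k. F (s (Suc i))) / real (Suc k)"
proof -
  have "F (\<Sum>i<Suc k. (1 / real (Suc k)) *\<^sub>R s (Suc i))
      \<le> (\<Sum>i<Suc k. 1 / real (Suc k) * F (s (Suc i)))"
    by (rule convex_on_sum[OF _ _ F]) (use s in auto)
  then show ?thesis
    unfolding ergodic_mean_as_convex_combination by (simp only: sum_divide_distrib times_divide_eq_left mult_1)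
qed

lemma bounded_if_sq_dist_bounded:
  fixes s :: "nat \<Rightarrow> 'a::real_normed_vector"
  assumes "\<And>k. (norm (c - s (Suc k)))\<^sup>2 \<le> B"
  shows "bounded (range s)"
proof -
  have "norm (s k) \<le> norm c + sqrt B + norm (s 0)" for k
  proof (cases k)
    case (Suc j)
    have "norm (c - s k) \<le> sqrt B" using assms[of j] Suc by (simp add: real_le_rsqrt)
    moreover have "norm (s k) \<le> norm c + norm (c - s k)"
      using norm_triangle_sub[of "s k" c] by (simp add: norm_minus_commute)
    ultimately show ?thesis using norm_ge_zero[of "s 0"] by linarith
  next
    case 0
    have "0 \<le> sqrt B" using assms[of 0] by (meson order_trans real_sqrt_ge_zero zero_le_power2)
    then show ?thesis using 0 by simp
  qed
  then show ?thesis unfolding bounded_iff by auto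
qed

lemma tendsto_0_if_sq_sums_bounded:
  fixes s :: "nat \<Rightarrow> real"
  assumes pos: "\<And>k. 0 \<le> s k" and bound: "\<And>k. (\<Sum>i<k. (s i)\<^sup>2) \<le> B"
  shows "s \<longlonglongrightarrow> 0"
proof -
  have "summable (\<lambda>i. (s i)\<^sup>2)"
    by (rule bounded_imp_summable[of _ B]) (use bound[of "Suc _"] in \<open>auto simp: lessThan_Suc_atMost\<close>)
  then have "(\<lambda>i. sqrt ((s i)\<^sup>2)) \<longlonglongrightarrow> sqrt 0"
    by (intro tendsto_real_sqrt summable_LIMSEQ_zero)
  then show ?thesis using pos by simp
qed

lemma incseq_le_limsup:
  fixes s :: "nat \<Rightarrow> real"
  assumes "incseq s"
  shows "ereal (s k) \<le> limsup (\<lambda>i. ereal (s i))"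
proof -
  have "incseq (\<lambda>i. ereal (s i))" using assms by (simp add: incseq_def)
  then have "limsup (\<lambda>i. ereal (s i)) = (SUP i. ereal (s i))"
    by (intro lim_imp_Limsup LIMSEQ_SUP) simp_all
  then show ?thesis by (metis SUP_upper UNIV_I)
qed

text \<open>The second bound follows by multiplying the two hypotheses: \<open>L T \<cdot> L S \<le> 1/4\<close>.\<close>

lemma positive_coefficients:
  fixes L T S :: real
  assumes "0 \<le> L" "0 < T" "0 < S" "L * T < 1 / 2" "L * S < 1 / 2"
  shows "0 < 1 / (2 * T) - L" and "0 < 1 / (2 * S) - L\<^sup>2 * T / 2"
proof -
  show "0 < 1 / (2 * T) - L" using assms by (simp add: field_simps)
  have "(L * T) * (L * S) \<le> (1 / 2) * (1 / 2)"
    using assms by (intro mult_mono) auto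
  then have "L\<^sup>2 * T * S < 1" by (simp add: power2_eq_square mult_ac)
  then show "0 < 1 / (2 * S) - L\<^sup>2 * T / 2" using assms by (simp add: field_simps)
qed

text \<open>A nondecreasing sequence stays below its limit superior, which is therefore a real upper bound
  meeting the same strict inequality.\<close>

lemma limsup_real_bound:
  fixes s :: "nat \<Rightarrow> real"
  assumes s: "incseq s" and fin: "limsup (\<lambda>i. ereal (s i)) < \<infinity>"
    and L: "ereal L * limsup (\<lambda>i. ereal (s i)) < ereal r"
  obtains T where "\<And>k. s k \<le> T" "L * T < r"
proof -
  have "limsup (\<lambda>i. ereal (s i)) \<noteq> - \<infinity>" using incseq_le_limsup[OF s, of 0] by auto
  with fin obtain T where T: "limsup (\<lambda>i. ereal (s i)) = ereal T"
    by (cases "limsup (\<lambda>i. ereal (s i))") auto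
  show thesis
    by (rule that[of T]) (use incseq_le_limsup[OF s] L in \<open>simp_all add: T\<close>)
qed

section \<open>Bilinear estimates\<close>

lemma onorm_inner_bound:
  assumes K: "bounded_linear K"
  shows "K u \<bullet> v \<le> onorm K * (norm u * norm v)"
proof -
  have "K u \<bullet> v \<le> norm (K u) * norm v" by (rule norm_cauchy_schwarz)
  also have "\<dots> \<le> (onorm K * norm u) * norm v"
    using onorm[OF K] by (rule mult_right_mono) simp
  finally show ?thesis by (simp add: mult.assoc)
qed

text \<open>The weight \<open>c\<close> is charged entirely to \<open>v\<close>; it will be \<open>1\<close>, or the factor \<open>1 - a k\<close> of
  \<open>w - y (Suc k)\<close>, whose square is what the step-size recursion provides.\<close>

lemma weighted_bilinear_bound:
  assumes K: "bounded_linear K"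
  shows "c * (K u \<bullet> v) \<le> onorm K / 2 * ((norm u)\<^sup>2 + c\<^sup>2 * (norm v)\<^sup>2)"
proof -
  have "c * (K u \<bullet> v) = K u \<bullet> (c *\<^sub>R v)" by simp
  also have "\<dots> \<le> onorm K * (norm u * norm (c *\<^sub>R v))" by (rule onorm_inner_bound[OF K])
  also have "\<dots> \<le> onorm K * (((norm u)\<^sup>2 + (norm (c *\<^sub>R v))\<^sup>2) / 2)"
    using sum_squares_bound[of "norm u" "norm (c *\<^sub>R v)"] onorm_pos_le[OF K]
    by (intro mult_left_mono) auto
  also have "\<dots> = onorm K / 2 * ((norm u)\<^sup>2 + c\<^sup>2 * (norm v)\<^sup>2)"
    by (simp add: power_mult_distrib)
  finally show ?thesis .
qed

text \<open>Young's inequality balanced so that the first summand is exactly the last increment term left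
  over by the telescoped estimate.\<close>

lemma young_bilinear_bound:
  assumes K: "bounded_linear K" and t: "0 < t"
  shows "K u \<bullet> v \<le> 1 / (2 * t) * (norm u)\<^sup>2 + (onorm K)\<^sup>2 * t / 2 * (norm v)\<^sup>2"
proof -
  have "0 \<le> (norm u - onorm K * t * norm v)\<^sup>2 / (2 * t)" using t by simp
  also have "\<dots> = 1 / (2 * t) * (norm u)\<^sup>2 + (onorm K)\<^sup>2 * t / 2 * (norm v)\<^sup>2
      - onorm K * (norm u * norm v)"
    using t by (simp add: power2_eq_square field_simps)
  finally show ?thesis using onorm_inner_bound[OF K, of u v] by linarith
qed

section \<open>Telescoping the primal-dual gap\<close>

text \<open>The scheme seen only through the inequalities that its proximal steps satisfy, for real-valued
  convex functions. The sequences \<open>a\<close> and \<open>b\<close> are the extrapolation parameters: \<open>a k\<close> stands for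
  \<open>\<alpha>\<close> at \<open>k - 1\<close>, the parameter that enters step \<open>k\<close>. At \<open>k = 0\<close> truncated subtraction turns
  \<open>x (k - 1)\<close> into \<open>x 0\<close>, which is the convention that the iterate of index \<open>-1\<close> equals \<open>x 0\<close>.\<close>

locale primal_dual_iteration =
  fixes K :: "'a::real_inner \<Rightarrow> 'b::real_inner"
    and G :: "'a \<Rightarrow> real" and H :: "'b \<Rightarrow> real"
    and X :: "'a set" and Y :: "'b set"
    and \<tau> \<sigma> a b :: "nat \<Rightarrow> real"
    and x :: "nat \<Rightarrow> 'a" and y :: "nat \<Rightarrow> 'b"
  assumes K: "bounded_linear K"
    and G: "convex_on X G" and H: "convex_on Y H"
    and x_in: "\<And>k. x k \<in> X" and y_in: "\<And>k. y k \<in> Y"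
    and \<tau>_pos: "\<And>k. 0 < \<tau> k" and \<sigma>_pos: "\<And>k. 0 < \<sigma> k"
    and \<tau>_step: "\<And>k. onorm K * (b k)\<^sup>2 = 1 / \<tau> k - 1 / \<tau> (Suc k)"
    and \<sigma>_step: "\<And>k. onorm K * (1 - a k)\<^sup>2 = 1 / \<sigma> k - 1 / \<sigma> (Suc k)"
    and x_step: "\<And>k z. z \<in> X \<Longrightarrow> G (x (Suc k)) - G z \<le>
      1 / (2 * \<tau> k) * ((norm (z - x k))\<^sup>2 - (norm (x k - x (Suc k)))\<^sup>2 - (norm (z - x (Suc k)))\<^sup>2)
      + K (z - x (Suc k)) \<bullet> (y (Suc k) + b k *\<^sub>R (y (Suc k) - y k))"
    and y_step: "\<And>k w. w \<in> Y \<Longrightarrow> H (y (Suc k)) - H w \<le>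
      1 / (2 * \<sigma> k) * ((norm (w - y k))\<^sup>2 - (norm (y k - y (Suc k)))\<^sup>2 - (norm (w - y (Suc k)))\<^sup>2)
      - K (x k + a k *\<^sub>R (x k - x (k - 1))) \<bullet> (w - y (Suc k))"
begin

text \<open>Agrees with \<open>bilinear_saddle K g h\<close> where \<open>G\<close> and \<open>H\<close> are the finite values of \<open>g\<close> and \<open>h\<close>.\<close>

definition \<Phi> :: "'a \<Rightarrow> 'b \<Rightarrow> real" where
  "\<Phi> u v = K u \<bullet> v + G u - H v"

lemma onorm_nonneg: "0 \<le> onorm K"
  by (rule onorm_pos_le[OF K])

text \<open>With \<open>x1, x0, xm\<close> three consecutive primal iterates and \<open>y1, y0\<close> two dual ones, the coupling
  terms split into a telescoping pair, a product of increments, and two errors with factors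
  \<open>1 - s\<close> and \<open>t\<close> that measure the deviation from the extrapolation parameters \<open>1\<close> and \<open>0\<close>.\<close>

lemma cross_terms:
  "K x1 \<bullet> w - K z \<bullet> y1 + K (z - x1) \<bullet> (y1 + t *\<^sub>R (y1 - y0))
      - K (x0 + s *\<^sub>R (x0 - xm)) \<bullet> (w - y1)
   = K (x1 - x0) \<bullet> (w - y1) - K (x0 - xm) \<bullet> (w - y0)
     + K (x0 - xm) \<bullet> (y1 - y0) + (1 - s) * (K (x0 - xm) \<bullet> (w - y1))
     + t * (K (z - x1) \<bullet> (y1 - y0))"
proof -
  interpret bounded_linear K by (rule K)
  show ?thesis by (simp add: diff add scaleR inner_simps algebra_simps)
qed

text \<open>Each of the three nontelescoping coupling terms is split by Young's inequality. The parts with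
  the factors \<open>(1 - a k)\<^sup>2\<close> and \<open>(b k)\<^sup>2\<close> are absorbed by the step-size recursions, which advance
  the weights of the squared distances to index \<open>Suc k\<close>; the rest is charged to the increments.\<close>

lemma gap_step:
  assumes z: "z \<in> X" and w: "w \<in> Y"
  shows "\<Phi> (x (Suc k)) w - \<Phi> z (y (Suc k)) \<le>
      1 / (2 * \<tau> k) * (norm (z - x k))\<^sup>2 - 1 / (2 * \<tau> (Suc k)) * (norm (z - x (Suc k)))\<^sup>2
    + 1 / (2 * \<sigma> k) * (norm (w - y k))\<^sup>2 - 1 / (2 * \<sigma> (Suc k)) * (norm (w - y (Suc k)))\<^sup>2
    - (1 / (2 * \<sigma> k) - onorm K) * (norm (y k - y (Suc k)))\<^sup>2
    - 1 / (2 * \<tau> k) * (norm (x k - x (Suc k)))\<^sup>2 + onorm K * (norm (x k - x (k - 1)))\<^sup>2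
    + K (x (Suc k) - x k) \<bullet> (w - y (Suc k)) - K (x k - x (k - 1)) \<bullet> (w - y k)"
proof -
  let ?L = "onorm K"
  let ?p = "(norm (x k - x (k - 1)))\<^sup>2" and ?q = "(norm (y k - y (Suc k)))\<^sup>2"
    and ?zx = "(norm (z - x (Suc k)))\<^sup>2" and ?wy = "(norm (w - y (Suc k)))\<^sup>2"
  have c1: "K (x k - x (k - 1)) \<bullet> (y (Suc k) - y k) \<le> ?L / 2 * (?p + ?q)"
    using weighted_bilinear_bound[OF K, of 1 "x k - x (k - 1)" "y (Suc k) - y k"]
    by (simp add: norm_minus_commute)
  have "(1 - a k) * (K (x k - x (k - 1)) \<bullet> (w - y (Suc k)))
      \<le> ?L / 2 * (?p + (1 - a k)\<^sup>2 * ?wy)"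
    by (rule weighted_bilinear_bound[OF K])
  also have "\<dots> = ?L / 2 * ?p + (?L * (1 - a k)\<^sup>2) / 2 * ?wy" by (simp add: field_simps)
  finally have c2: "(1 - a k) * (K (x k - x (k - 1)) \<bullet> (w - y (Suc k)))
      \<le> ?L / 2 * ?p + (1 / \<sigma> k - 1 / \<sigma> (Suc k)) / 2 * ?wy"
    unfolding \<sigma>_step .
  \<comment> \<open>The factor \<open>b k\<close> is moved to the primal side, whose weight the recursion for \<open>\<tau>\<close> governs.\<close>
  have "b k * (K (z - x (Suc k)) \<bullet> (y (Suc k) - y k))
      = 1 * (K (b k *\<^sub>R (z - x (Suc k))) \<bullet> (y (Suc k) - y k))"
    using K by (simp add: bounded_linear.linear linear_scale)
  also have "\<dots> \<le> ?L / 2 * ((norm (b k *\<^sub>R (z - x (Suc k))))\<^sup>2 + 1\<^sup>2 * (norm (y (Suc k) - y k))\<^sup>2)"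
    by (rule weighted_bilinear_bound[OF K])
  also have "\<dots> = (?L * (b k)\<^sup>2) / 2 * ?zx + ?L / 2 * ?q"
    unfolding norm_scaleR power_mult_distrib by (simp add: norm_minus_commute field_simps)
  finally have c3: "b k * (K (z - x (Suc k)) \<bullet> (y (Suc k) - y k))
      \<le> (1 / \<tau> k - 1 / \<tau> (Suc k)) / 2 * ?zx + ?L / 2 * ?q"
    unfolding \<tau>_step .
  have "\<Phi> (x (Suc k)) w - \<Phi> z (y (Suc k)) \<le>
      1 / (2 * \<tau> k) * ((norm (z - x k))\<^sup>2 - (norm (x k - x (Suc k)))\<^sup>2 - ?zx)
    + 1 / (2 * \<sigma> k) * ((norm (w - y k))\<^sup>2 - ?q - ?wy)
    + (K (x (Suc k)) \<bullet> w - K z \<bullet> y (Suc k)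
      + K (z - x (Suc k)) \<bullet> (y (Suc k) + b k *\<^sub>R (y (Suc k) - y k))
      - K (x k + a k *\<^sub>R (x k - x (k - 1))) \<bullet> (w - y (Suc k)))"
    using x_step[OF z, of k] y_step[OF w, of k] unfolding \<Phi>_def by linarith
  also have "\<dots> \<le> 1 / (2 * \<tau> k) * ((norm (z - x k))\<^sup>2 - (norm (x k - x (Suc k)))\<^sup>2 - ?zx)
    + 1 / (2 * \<sigma> k) * ((norm (w - y k))\<^sup>2 - ?q - ?wy)
    + (K (x (Suc k) - x k) \<bullet> (w - y (Suc k)) - K (x k - x (k - 1)) \<bullet> (w - y k)
      + ?L / 2 * (?p + ?q) + (?L / 2 * ?p + (1 / \<sigma> k - 1 / \<sigma> (Suc k)) / 2 * ?wy)
      + ((1 / \<tau> k - 1 / \<tau> (Suc k)) / 2 * ?zx + ?L / 2 * ?q))"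
    unfolding cross_terms using c1 c2 c3 by linarith
  finally have bound: "\<Phi> (x (Suc k)) w - \<Phi> z (y (Suc k)) \<le> \<dots>" .
  \<comment> \<open>Naming the reciprocals makes the rest an identity of polynomials.\<close>
  define p q where "p = 1 / (2 * \<tau> k)" and "q = 1 / (2 * \<sigma> k)"
  define p' q' where "p' = 1 / (2 * \<tau> (Suc k))" and "q' = 1 / (2 * \<sigma> (Suc k))"
  have half: "(1 / \<tau> k - 1 / \<tau> (Suc k)) / 2 = p - p'" "(1 / \<sigma> k - 1 / \<sigma> (Suc k)) / 2 = q - q'"
    unfolding p_def q_def p'_def q'_def by (simp_all add: field_simps)
  show ?thesis
    using bound unfolding half p_def[symmetric] q_def[symmetric] p'_def[symmetric] q'_def[symmetric]
    by (simp add: algebra_simps)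
qed

text \<open>Step \<open>k\<close> leaves the previous primal increment with the weight \<open>onorm K\<close> and brings the new one with
  \<open>1 / (2 * \<tau> k)\<close>. The invariant hence carries the last primal increment separately, together with
  the telescoping coupling term.\<close>

lemma gap_telescope:
  assumes z: "z \<in> X" and w: "w \<in> Y"
  shows "(\<Sum>i<k. \<Phi> (x (Suc i)) w - \<Phi> z (y (Suc i)))
    + 1 / (2 * \<tau> k) * (norm (z - x k))\<^sup>2 + 1 / (2 * \<sigma> k) * (norm (w - y k))\<^sup>2
    + (\<Sum>i<k. (1 / (2 * \<tau> i) - onorm K) * (norm (x i - x (Suc i)))\<^sup>2)
    + (\<Sum>i<k. (1 / (2 * \<sigma> i) - onorm K) * (norm (y i - y (Suc i)))\<^sup>2)
    + onorm K * (norm (x k - x (k - 1)))\<^sup>2 - K (x k - x (k - 1)) \<bullet> (w - y k)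
    \<le> 1 / (2 * \<tau> 0) * (norm (z - x 0))\<^sup>2 + 1 / (2 * \<sigma> 0) * (norm (w - y 0))\<^sup>2"
proof (induction k)
  case 0
  then show ?case using K by (simp add: bounded_linear.linear linear_0)
next
  case (Suc k)
  have "(1 / (2 * \<tau> k) - onorm K) * (norm (x k - x (Suc k)))\<^sup>2
      + onorm K * (norm (x (Suc k) - x k))\<^sup>2 = 1 / (2 * \<tau> k) * (norm (x k - x (Suc k)))\<^sup>2"
    by (simp add: norm_minus_commute algebra_simps)
  with Suc.IH gap_step[OF z w, of k] show ?case
    by (simp del: times_divide_eq_left times_divide_eq_right)
qed

text \<open>The remaining coupling term is eliminated against the last primal increment, which is why the
  sum over the primal increments stops one index earlier and the weight of the dual distance
  decreases by \<open>(onorm K)\<^sup>2 * \<tau> k / 2\<close>.\<close>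

lemma gap_sum_bound:
  assumes z: "z \<in> X" and w: "w \<in> Y"
  shows "(\<Sum>i<Suc k. \<Phi> (x (Suc i)) w - \<Phi> z (y (Suc i)))
    + 1 / (2 * \<tau> (Suc k)) * (norm (z - x (Suc k)))\<^sup>2
    + (1 / (2 * \<sigma> (Suc k)) - (onorm K)\<^sup>2 * \<tau> k / 2) * (norm (w - y (Suc k)))\<^sup>2
    + (\<Sum>i<k. (1 / (2 * \<tau> i) - onorm K) * (norm (x i - x (Suc i)))\<^sup>2)
    + (\<Sum>i<Suc k. (1 / (2 * \<sigma> i) - onorm K) * (norm (y i - y (Suc i)))\<^sup>2)
    \<le> 1 / (2 * \<tau> 0) * (norm (z - x 0))\<^sup>2 + 1 / (2 * \<sigma> 0) * (norm (w - y 0))\<^sup>2"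
proof -
  have split: "(\<Sum>i<Suc k. (1 / (2 * \<tau> i) - onorm K) * (norm (x i - x (Suc i)))\<^sup>2)
      = (\<Sum>i<k. (1 / (2 * \<tau> i) - onorm K) * (norm (x i - x (Suc i)))\<^sup>2)
        + 1 / (2 * \<tau> k) * (norm (x (Suc k) - x k))\<^sup>2 - onorm K * (norm (x (Suc k) - x k))\<^sup>2"
    by (simp add: norm_minus_commute left_diff_distrib)
  have wy: "(1 / (2 * \<sigma> (Suc k)) - (onorm K)\<^sup>2 * \<tau> k / 2) * (norm (w - y (Suc k)))\<^sup>2
      = 1 / (2 * \<sigma> (Suc k)) * (norm (w - y (Suc k)))\<^sup>2
        - (onorm K)\<^sup>2 * \<tau> k / 2 * (norm (w - y (Suc k)))\<^sup>2"
    by (rule left_diff_distrib)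
  show ?thesis
    using gap_telescope[OF z w, of "Suc k"]
      young_bilinear_bound[OF K \<tau>_pos, of "x (Suc k) - x k" "w - y (Suc k)" k]
    unfolding split wy diff_Suc_1 by linarith
qed

text \<open>The left-hand sides of the step-size recursions are nonnegative.\<close>

lemma incseq_\<tau>: "incseq \<tau>"
proof (rule incseq_SucI)
  fix k
  have "1 / \<tau> (Suc k) \<le> 1 / \<tau> k"
    using \<tau>_step[of k] onorm_nonneg zero_le_mult_iff[of "onorm K" "(b k)\<^sup>2"] by simp
  then show "\<tau> k \<le> \<tau> (Suc k)"
    using \<tau>_pos[of k] \<tau>_pos[of "Suc k"] by (simp add: field_simps)
qed

lemma incseq_\<sigma>: "incseq \<sigma>"
proof (rule incseq_SucI)
  fix k
  have "1 / \<sigma> (Suc k) \<le> 1 / \<sigma> k"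
    using \<sigma>_step[of k] onorm_nonneg zero_le_mult_iff[of "onorm K" "(1 - a k)\<^sup>2"] by simp
  then show "\<sigma> k \<le> \<sigma> (Suc k)"
    using \<sigma>_pos[of k] \<sigma>_pos[of "Suc k"] by (simp add: field_simps)
qed

text \<open>Upper bounds on the step sizes replace the varying coefficients from index \<open>n\<close> on; the first
  \<open>n\<close> increments keep theirs and move to the right-hand side. The case \<open>n = 0\<close> has nothing
  left over.\<close>

lemma uniform_gap_sum_bound:
  assumes z: "z \<in> X" and w: "w \<in> Y"
    and T: "\<And>k. \<tau> k \<le> T" and S: "\<And>k. \<sigma> k \<le> S" and n: "n \<le> k"
  shows "(\<Sum>i<Suc k. \<Phi> (x (Suc i)) w - \<Phi> z (y (Suc i)))
    + 1 / (2 * T) * (norm (z - x (Suc k)))\<^sup>2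
    + (1 / (2 * S) - (onorm K)\<^sup>2 * T / 2) * (norm (w - y (Suc k)))\<^sup>2
    + (1 / (2 * T) - onorm K) * (\<Sum>i=n..<k. (norm (x i - x (Suc i)))\<^sup>2)
    + (1 / (2 * S) - onorm K) * (\<Sum>i=n..<Suc k. (norm (y i - y (Suc i)))\<^sup>2)
    \<le> 1 / (2 * \<tau> 0) * (norm (z - x 0))\<^sup>2 + 1 / (2 * \<sigma> 0) * (norm (w - y 0))\<^sup>2
      + (\<Sum>i<n. (onorm K - 1 / (2 * \<tau> i)) * (norm (x i - x (Suc i)))\<^sup>2)
      + (\<Sum>i<n. (onorm K - 1 / (2 * \<sigma> i)) * (norm (y i - y (Suc i)))\<^sup>2)"
proof -
  have \<tau>: "1 / (2 * T) \<le> 1 / (2 * \<tau> i)" for i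
    using \<tau>_pos[of i] T[of i] by (intro divide_left_mono) auto
  have \<sigma>: "1 / (2 * S) \<le> 1 / (2 * \<sigma> i)" for i
    using \<sigma>_pos[of i] S[of i] by (intro divide_left_mono) auto
  have split: "(\<Sum>i<m. (p i - q) * r i)
      = (\<Sum>i=n..<m. (p i - q) * r i) - (\<Sum>i<n. (q - p i) * r i)"
    if "n \<le> m" for m and p r :: "nat \<Rightarrow> real" and q :: real
  proof -
    have "(\<Sum>i<m. (p i - q) * r i) = (\<Sum>i<n. (p i - q) * r i) + (\<Sum>i=n..<m. (p i - q) * r i)"
      using sum.atLeastLessThan_concat[of 0 n m "\<lambda>i. (p i - q) * r i"] that
      by (simp add: atLeast0LessThan)
    moreover have "(\<Sum>i<n. (p i - q) * r i) = - (\<Sum>i<n. (q - p i) * r i)"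
      unfolding sum_negf[symmetric] by (rule sum.cong) (auto simp: algebra_simps)
    ultimately show ?thesis by simp
  qed
  have "1 / (2 * T) * (norm (z - x (Suc k)))\<^sup>2 \<le> 1 / (2 * \<tau> (Suc k)) * (norm (z - x (Suc k)))\<^sup>2"
    by (intro mult_right_mono \<tau>) simp
  moreover have "(onorm K)\<^sup>2 * \<tau> k / 2 \<le> (onorm K)\<^sup>2 * T / 2"
    using T[of k] by (simp add: mult_left_mono)
  then have "(1 / (2 * S) - (onorm K)\<^sup>2 * T / 2) * (norm (w - y (Suc k)))\<^sup>2
      \<le> (1 / (2 * \<sigma> (Suc k)) - (onorm K)\<^sup>2 * \<tau> k / 2) * (norm (w - y (Suc k)))\<^sup>2"
    using \<sigma>[of "Suc k"] by (intro mult_right_mono) auto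
  moreover have "(1 / (2 * T) - onorm K) * (\<Sum>i=n..<k. (norm (x i - x (Suc i)))\<^sup>2)
      \<le> (\<Sum>i=n..<k. (1 / (2 * \<tau> i) - onorm K) * (norm (x i - x (Suc i)))\<^sup>2)"
    unfolding sum_distrib_left using \<tau> by (intro sum_mono mult_right_mono) auto
  moreover have "(1 / (2 * S) - onorm K) * (\<Sum>i=n..<Suc k. (norm (y i - y (Suc i)))\<^sup>2)
      \<le> (\<Sum>i=n..<Suc k. (1 / (2 * \<sigma> i) - onorm K) * (norm (y i - y (Suc i)))\<^sup>2)"
    unfolding sum_distrib_left using \<sigma> by (intro sum_mono mult_right_mono) auto
  ultimately show ?thesis
    using gap_sum_bound[OF z w, of k] unfolding split[OF n] split[OF le_SucI[OF n]] by linarith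
qed

text \<open>The gap is convex in the primal and in the dual iterate, so Jensen's inequality applies.\<close>

lemma ergodic_gap:
  assumes z: "z \<in> X" and w: "w \<in> Y"
  shows "\<Phi> (ergodic_mean x k) w - \<Phi> z (ergodic_mean y k)
    \<le> (\<Sum>i<Suc k. \<Phi> (x (Suc i)) w - \<Phi> z (y (Suc i))) / real (Suc k)"
proof -
  interpret bounded_linear K by (rule K)
  have conv: "convex X" "convex Y" using G H by (auto simp: convex_on_def)
  have "convex_on X (\<lambda>u. \<Phi> u w)"
  proof (rule convex_onI[OF _ conv(1)])
    fix t u v assume *: "(0::real) < t" "t < 1" "u \<in> X" "v \<in> X"
    show "\<Phi> ((1 - t) *\<^sub>R u + t *\<^sub>R v) w \<le> (1 - t) * \<Phi> u w + t * \<Phi> v w"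
      using convex_onD[OF G, of t u v] * unfolding \<Phi>_def add scaleR inner_simps
      by (simp add: algebra_simps)
  qed
  moreover have "convex_on Y (\<lambda>v. - \<Phi> z v)"
  proof (rule convex_onI[OF _ conv(2)])
    fix t u v assume *: "(0::real) < t" "t < 1" "u \<in> Y" "v \<in> Y"
    show "- \<Phi> z ((1 - t) *\<^sub>R u + t *\<^sub>R v) \<le> (1 - t) * - \<Phi> z u + t * - \<Phi> z v"
      using convex_onD[OF H, of t u v] * unfolding \<Phi>_def inner_simps
      by (simp add: algebra_simps)
  qed
  ultimately have "\<Phi> (ergodic_mean x k) w + - \<Phi> z (ergodic_mean y k)
      \<le> (\<Sum>i<Suc k. \<Phi> (x (Suc i)) w) / real (Suc k) + (\<Sum>i<Suc k. - \<Phi> z (y (Suc i))) / real (Suc k)"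
    using x_in y_in by (intro add_mono ergodic_mean_Jensen)
  then show ?thesis
    by (simp add: sum_subtractf sum_negf diff_divide_distrib del: sum.lessThan_Suc)
qed

end

locale primal_dual_saddle = primal_dual_iteration K G H X Y \<tau> \<sigma> a b x y
  for K :: "'a::real_inner \<Rightarrow> 'b::real_inner"
    and G :: "'a \<Rightarrow> real" and H :: "'b \<Rightarrow> real"
    and X :: "'a set" and Y :: "'b set"
    and \<tau> \<sigma> a b :: "nat \<Rightarrow> real"
    and x :: "nat \<Rightarrow> 'a" and y :: "nat \<Rightarrow> 'b" +
  fixes xs :: 'a and ys :: 'b
  assumes xs: "xs \<in> X" and ys: "ys \<in> Y"
    and saddle_max: "\<And>v. v \<in> Y \<Longrightarrow> \<Phi> xs v \<le> \<Phi> xs ys"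
    and saddle_min: "\<And>u. u \<in> X \<Longrightarrow> \<Phi> xs ys \<le> \<Phi> u ys"
begin

lemma saddle_gap_sum_nonneg: "0 \<le> (\<Sum>i<k. \<Phi> (x (Suc i)) ys - \<Phi> xs (y (Suc i)))"
  using saddle_max[OF y_in] saddle_min[OF x_in]
  by (intro sum_nonneg) (meson diff_ge_0_iff_ge order_trans)

lemma saddle_energy:
  "1 / (2 * \<tau> (Suc k)) * (norm (xs - x (Suc k)))\<^sup>2
    + (1 / (2 * \<sigma> (Suc k)) - (onorm K)\<^sup>2 * \<tau> k / 2) * (norm (ys - y (Suc k)))\<^sup>2
    + (\<Sum>i<k. (1 / (2 * \<tau> i) - onorm K) * (norm (x i - x (Suc i)))\<^sup>2)
    + (\<Sum>i<Suc k. (1 / (2 * \<sigma> i) - onorm K) * (norm (y i - y (Suc i)))\<^sup>2)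
    \<le> 1 / (2 * \<tau> 0) * (norm (xs - x 0))\<^sup>2 + 1 / (2 * \<sigma> 0) * (norm (ys - y 0))\<^sup>2"
  using gap_sum_bound[OF xs ys, of k] saddle_gap_sum_nonneg[of "Suc k"] by linarith

lemma saddle_energy_tail:
  assumes T: "\<And>k. \<tau> k \<le> T" and S: "\<And>k. \<sigma> k \<le> S" and N: "N < k"
  shows "1 / (2 * T) * (norm (xs - x (Suc k)))\<^sup>2
    + (1 / (2 * S) - (onorm K)\<^sup>2 * T / 2) * (norm (ys - y (Suc k)))\<^sup>2
    + (1 / (2 * T) - onorm K) * (\<Sum>i=Suc N..<k. (norm (x i - x (Suc i)))\<^sup>2)
    + (1 / (2 * S) - onorm K) * (\<Sum>i=Suc N..k. (norm (y i - y (Suc i)))\<^sup>2)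
    \<le> 1 / (2 * \<tau> 0) * (norm (xs - x 0))\<^sup>2 + 1 / (2 * \<sigma> 0) * (norm (ys - y 0))\<^sup>2
      + (\<Sum>i=0..N. (onorm K - 1 / (2 * \<tau> i)) * (norm (x i - x (Suc i)))\<^sup>2)
      + (\<Sum>i=0..N. (onorm K - 1 / (2 * \<sigma> i)) * (norm (y i - y (Suc i)))\<^sup>2)"
proof -
  have "Suc N \<le> k" using N by simp
  then show ?thesis
    using uniform_gap_sum_bound[OF xs ys T S, of "Suc N" k] saddle_gap_sum_nonneg[of "Suc k"]
    unfolding lessThan_Suc_atMost atLeastLessThanSuc_atLeastAtMost atLeast0AtMost by linarith
qed

end

locale primal_dual_bounded_steps = primal_dual_saddle K G H X Y \<tau> \<sigma> a b x y xs ys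
  for K :: "'a::real_inner \<Rightarrow> 'b::real_inner"
    and G :: "'a \<Rightarrow> real" and H :: "'b \<Rightarrow> real"
    and X :: "'a set" and Y :: "'b set"
    and \<tau> \<sigma> a b :: "nat \<Rightarrow> real"
    and x :: "nat \<Rightarrow> 'a" and y :: "nat \<Rightarrow> 'b"
    and xs :: 'a and ys :: 'b +
  fixes T S :: real
  assumes T: "\<And>k. \<tau> k \<le> T" "onorm K * T < 1 / 2"
    and S: "\<And>k. \<sigma> k \<le> S" "onorm K * S < 1 / 2"
begin

lemma uniform_coefficients_pos:
  "0 < T" "0 < S" "0 < 1 / (2 * T) - onorm K" "0 < 1 / (2 * S) - onorm K"
  "0 < 1 / (2 * S) - (onorm K)\<^sup>2 * T / 2"
proof -
  show T0: "0 < T" and S0: "0 < S"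
    using T(1)[of 0] S(1)[of 0] \<tau>_pos[of 0] \<sigma>_pos[of 0] by linarith+
  show "0 < 1 / (2 * T) - onorm K" "0 < 1 / (2 * S) - (onorm K)\<^sup>2 * T / 2"
    by (rule positive_coefficients[OF onorm_nonneg T0 S0 T(2) S(2)])+
  show "0 < 1 / (2 * S) - onorm K"
    by (rule positive_coefficients(1)[OF onorm_nonneg S0 T0 S(2) T(2)])
qed

text \<open>All terms on the left of the energy inequality are nonnegative, so each is bounded on its own.\<close>

lemma saddle_term_bounds:
  defines "C \<equiv> 1 / (2 * \<tau> 0) * (norm (xs - x 0))\<^sup>2 + 1 / (2 * \<sigma> 0) * (norm (ys - y 0))\<^sup>2"
  shows "1 / (2 * T) * (norm (xs - x (Suc k)))\<^sup>2 \<le> C"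
    and "(1 / (2 * S) - (onorm K)\<^sup>2 * T / 2) * (norm (ys - y (Suc k)))\<^sup>2 \<le> C"
    and "(1 / (2 * T) - onorm K) * (\<Sum>i<k. (norm (x i - x (Suc i)))\<^sup>2) \<le> C"
    and "(1 / (2 * S) - onorm K) * (\<Sum>i<k. (norm (y i - y (Suc i)))\<^sup>2) \<le> C"
proof -
  have nonneg: "0 \<le> 1 / (2 * T) * (norm (xs - x (Suc k)))\<^sup>2"
    "0 \<le> (1 / (2 * S) - (onorm K)\<^sup>2 * T / 2) * (norm (ys - y (Suc k)))\<^sup>2"
    "0 \<le> (1 / (2 * T) - onorm K) * (\<Sum>i<k. (norm (x i - x (Suc i)))\<^sup>2)"
    "0 \<le> (1 / (2 * S) - onorm K) * (\<Sum>i<k. (norm (y i - y (Suc i)))\<^sup>2)"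
    "0 \<le> (1 / (2 * S) - onorm K) * (norm (y k - y (Suc k)))\<^sup>2"
    using uniform_coefficients_pos by (auto intro!: mult_nonneg_nonneg sum_nonneg)
  have "(1 / (2 * S) - onorm K) * (\<Sum>i<Suc k. (norm (y i - y (Suc i)))\<^sup>2)
    = (1 / (2 * S) - onorm K) * (\<Sum>i<k. (norm (y i - y (Suc i)))\<^sup>2)
      + (1 / (2 * S) - onorm K) * (norm (y k - y (Suc k)))\<^sup>2"
    by (simp only: sum.lessThan_Suc distrib_left)
  note bounds = uniform_gap_sum_bound[OF xs ys T(1) S(1) le0, of k, unfolded atLeast0LessThan this lessThan_0 sum.empty]
    saddle_gap_sum_nonneg[of "Suc k"] nonneg
  show "1 / (2 * T) * (norm (xs - x (Suc k)))\<^sup>2 \<le> C"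
    unfolding C_def using bounds by linarith
  show "(1 / (2 * S) - (onorm K)\<^sup>2 * T / 2) * (norm (ys - y (Suc k)))\<^sup>2 \<le> C"
    unfolding C_def using bounds by linarith
  show "(1 / (2 * T) - onorm K) * (\<Sum>i<k. (norm (x i - x (Suc i)))\<^sup>2) \<le> C"
    unfolding C_def using bounds by linarith
  show "(1 / (2 * S) - onorm K) * (\<Sum>i<k. (norm (y i - y (Suc i)))\<^sup>2) \<le> C"
    unfolding C_def using bounds by linarith
qed

lemma increments_tendsto_0:
  "(\<lambda>k. norm (x k - x (Suc k))) \<longlonglongrightarrow> 0" "(\<lambda>k. norm (y k - y (Suc k))) \<longlonglongrightarrow> 0"
proof -
  note bounds = saddle_term_bounds(3,4)[unfolded mult.commute[of "_ - onorm K"]]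
  show "(\<lambda>k. norm (x k - x (Suc k))) \<longlonglongrightarrow> 0"
    by (rule tendsto_0_if_sq_sums_bounded[OF norm_ge_zero])
      (rule bounds(1)[folded pos_le_divide_eq[OF uniform_coefficients_pos(3)]])
  show "(\<lambda>k. norm (y k - y (Suc k))) \<longlonglongrightarrow> 0"
    by (rule tendsto_0_if_sq_sums_bounded[OF norm_ge_zero])
      (rule bounds(2)[folded pos_le_divide_eq[OF uniform_coefficients_pos(4)]])
qed

lemma iterates_bounded: "bounded (range x)" "bounded (range y)"
proof -
  have coeff: "0 < 1 / (2 * T)" using uniform_coefficients_pos(1) by simp
  show "bounded (range x)"
    by (rule bounded_if_sq_dist_bounded)
      (rule saddle_term_bounds(1)[unfolded mult.commute[of "1 / (2 * T)"],
          folded pos_le_divide_eq[OF coeff]])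
  show "bounded (range y)"
    by (rule bounded_if_sq_dist_bounded)
      (rule saddle_term_bounds(2)[unfolded mult.commute[of "_ - (onorm K)\<^sup>2 * T / 2"],
          folded pos_le_divide_eq[OF uniform_coefficients_pos(5)]])
qed

lemma ergodic_means_bounded:
  "bounded (range (ergodic_mean x))" "bounded (range (ergodic_mean y))"
proof -
  have "bounded (range (ergodic_mean s))" if "bounded (range s)" for s :: "nat \<Rightarrow> 'c::real_normed_vector"
  proof -
    from that obtain B where "\<And>i. s i \<in> cball 0 B" unfolding bounded_iff by auto
    then have "ergodic_mean s k \<in> cball 0 B" for k
      by (intro ergodic_mean_in_convex) auto
    then show ?thesis by (intro bounded_subset[OF bounded_cball[of 0 B]]) auto
  qed
  then show "bounded (range (ergodic_mean x))" "bounded (range (ergodic_mean y))"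
    using iterates_bounded by auto
qed

text \<open>Here \<open>z\<close> and \<open>w\<close> are arbitrary and the bound is explicit in them, so that they may
  later be chosen depending on \<open>k\<close>.\<close>

lemma ergodic_gap_rate:
  assumes z: "z \<in> X" and w: "w \<in> Y"
  shows "\<Phi> (ergodic_mean x k) w - \<Phi> z (ergodic_mean y k) \<le>
    (1 / (2 * \<tau> 0) * (norm (z - x 0))\<^sup>2 + 1 / (2 * \<sigma> 0) * (norm (w - y 0))\<^sup>2) / real (Suc k)"
proof -
  have "0 \<le> 1 / (2 * T) * (norm (z - x (Suc k)))\<^sup>2"
    "0 \<le> (1 / (2 * S) - (onorm K)\<^sup>2 * T / 2) * (norm (w - y (Suc k)))\<^sup>2"
    "0 \<le> (1 / (2 * T) - onorm K) * (\<Sum>i<k. (norm (x i - x (Suc i)))\<^sup>2)"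
    "0 \<le> (1 / (2 * S) - onorm K) * (\<Sum>i<Suc k. (norm (y i - y (Suc i)))\<^sup>2)"
    using uniform_coefficients_pos
    by (auto intro!: mult_nonneg_nonneg sum_nonneg simp del: sum.lessThan_Suc)
  with uniform_gap_sum_bound[OF z w T(1) S(1) le0, of k, unfolded atLeast0LessThan lessThan_0 sum.empty]
  have "(\<Sum>i<Suc k. \<Phi> (x (Suc i)) w - \<Phi> z (y (Suc i)))
    \<le> 1 / (2 * \<tau> 0) * (norm (z - x 0))\<^sup>2 + 1 / (2 * \<sigma> 0) * (norm (w - y 0))\<^sup>2" by linarith
  then show ?thesis
    using ergodic_gap[OF z w, of k] by (meson divide_right_mono of_nat_0_le_iff order_trans)
qed

text \<open>From above, the gap is tested at the saddle point in the primal and at the dual mean in the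
  dual variable; from below, at the primal mean and at the saddle point. The test points move with \<open>k\<close>
  but remain bounded, so both gaps vanish like \<open>M / Suc k\<close>.\<close>

lemma ergodic_value_tendsto:
  "(\<lambda>k. \<Phi> (ergodic_mean x k) (ergodic_mean y k)) \<longlonglongrightarrow> \<Phi> xs ys"
proof -
  let ?u = "ergodic_mean x" and ?v = "ergodic_mean y"
  have u: "?u k \<in> X" and v: "?v k \<in> Y" for k
    using G H x_in y_in by (auto intro!: ergodic_mean_in_convex simp: convex_on_def)
  obtain Bx where Bx: "\<And>k. norm (?u k) \<le> Bx"
    using ergodic_means_bounded(1) unfolding bounded_iff by auto
  obtain By where By: "\<And>k. norm (?v k) \<le> By"
    using ergodic_means_bounded(2) unfolding bounded_iff by auto
  define M where "M = 1 / (2 * \<tau> 0) * (norm xs + Bx + norm (x 0))\<^sup>2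
    + 1 / (2 * \<sigma> 0) * (norm ys + By + norm (y 0))\<^sup>2"
  have C: "1 / (2 * \<tau> 0) * (norm (z - x 0))\<^sup>2 + 1 / (2 * \<sigma> 0) * (norm (w - y 0))\<^sup>2 \<le> M"
    if "norm z \<le> norm xs + Bx" "norm w \<le> norm ys + By" for z w
  proof -
    have "norm (z - x 0) \<le> norm xs + Bx + norm (x 0)" "norm (w - y 0) \<le> norm ys + By + norm (y 0)"
      using that norm_triangle_ineq4[of z "x 0"] norm_triangle_ineq4[of w "y 0"] by linarith+
    then show ?thesis
      unfolding M_def using \<tau>_pos[of 0] \<sigma>_pos[of 0]
      by (intro add_mono mult_left_mono power_mono) auto
  qed
  have B0: "0 \<le> Bx" "0 \<le> By"
    using Bx[of 0] By[of 0] norm_ge_zero order_trans by blast+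
  have upper: "\<Phi> (?u k) (?v k) \<le> \<Phi> xs ys + M / real (Suc k)" for k
  proof -
    have "\<Phi> (?u k) (?v k) - \<Phi> xs (?v k) \<le> M / real (Suc k)"
      by (rule order_trans[OF ergodic_gap_rate[OF xs v] divide_right_mono[OF C]])
        (use B0 By[of k] in \<open>auto intro: add_increasing\<close>)
    with saddle_max[OF v, of k] show ?thesis by linarith
  qed
  have lower: "\<Phi> xs ys - M / real (Suc k) \<le> \<Phi> (?u k) (?v k)" for k
  proof -
    have "\<Phi> (?u k) ys - \<Phi> (?u k) (?v k) \<le> M / real (Suc k)"
      by (rule order_trans[OF ergodic_gap_rate[OF u ys] divide_right_mono[OF C]])
        (use B0 Bx[of k] in \<open>auto intro: add_increasing\<close>)
    with saddle_min[OF u, of k] show ?thesis by linarith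
  qed
  have "(\<lambda>k. M / real (Suc k)) \<longlonglongrightarrow> 0"
    using tendsto_mult_right_zero[OF LIMSEQ_inverse_real_of_nat, of M] by (simp add: divide_inverse)
  then have "(\<lambda>k. \<Phi> (?u k) (?v k) - \<Phi> xs ys) \<longlonglongrightarrow> 0"
  proof (rule Lim_null_comparison[rotated])
    show "\<forall>\<^sub>F k in sequentially. norm (\<Phi> (?u k) (?v k) - \<Phi> xs ys) \<le> M / real (Suc k)"
      unfolding real_norm_def abs_le_iff
      by (intro always_eventually allI conjI) (use lower upper in \<open>auto simp: algebra_simps\<close>)
  qed
  then show ?thesis by (rule LIM_zero_cancel)
qed

end

section \<open>Convergence of the iterate scheme\<close>

text \<open>An infinite value of \<open>g\<close> at one point of \<open>X\<close> makes \<open>f\<close> equal to \<open>\<infinity>\<close> on a whole section,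
  whatever \<open>h\<close> is; once \<open>g\<close> is finite, an infinite value of \<open>h\<close> makes \<open>f\<close> equal to \<open>-\<infinity>\<close>.\<close>

lemma finite_if_sections_proper:
  assumes XY: "Y \<noteq> {}" "X \<noteq> {}"
    and g: "proper_on UNIV g" and h: "proper_on UNIV h"
    and fst: "\<And>v. v \<in> Y \<Longrightarrow> proper_on X (\<lambda>u. bilinear_saddle K g h u v)"
    and snd: "\<And>u. u \<in> X \<Longrightarrow> proper_on Y (\<lambda>v. - bilinear_saddle K g h u v)"
  shows "u \<in> X \<Longrightarrow> g u = ereal (real_of_ereal (g u))"
    and "v \<in> Y \<Longrightarrow> h v = ereal (real_of_ereal (h v))"
proof -
  have "g u \<noteq> \<infinity> \<and> h v \<noteq> \<infinity>" if "u \<in> X" "v \<in> Y" for u v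
  proof -
    have "bilinear_saddle K g h u v \<noteq> - \<infinity>" "bilinear_saddle K g h u v \<noteq> \<infinity>"
      using fst[OF that(2)] snd[OF that(1)] that unfolding proper_on_def
      by (auto simp: ereal_uminus_eq_reorder)
    moreover have "g u \<noteq> - \<infinity>" "h v \<noteq> - \<infinity>" using g h unfolding proper_on_def by auto
    ultimately show ?thesis unfolding bilinear_saddle_def
      by (cases "g u"; cases "h v") auto
  qed
  moreover have "g u \<noteq> - \<infinity>" "h v \<noteq> - \<infinity>" for u v
    using g h unfolding proper_on_def by auto
  ultimately have "\<forall>u\<in>X. g u \<noteq> \<infinity> \<and> g u \<noteq> - \<infinity>" "\<forall>v\<in>Y. h v \<noteq> \<infinity> \<and> h v \<noteq> - \<infinity>"
    using XY by blast+
  then show "u \<in> X \<Longrightarrow> g u = ereal (real_of_ereal (g u))"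
    and "v \<in> Y \<Longrightarrow> h v = ereal (real_of_ereal (h v))"
    by (auto simp: ereal_real)
qed

theorem theorem4p1:
  fixes K :: "'a::{real_inner, complete_space} \<Rightarrow> 'b::{real_inner, complete_space}"
    and g :: "'a \<Rightarrow> ereal" and h :: "'b \<Rightarrow> ereal"
    and X :: "'a set" and Y :: "'b set"
    and \<tau> \<sigma> :: "nat \<Rightarrow> real" and \<alpha> \<beta> :: "int \<Rightarrow> real"
    and x xb :: "nat \<Rightarrow> 'a" and y yb :: "nat \<Rightarrow> 'b"
    and xs :: 'a and ys :: 'b
  defines "f \<equiv> bilinear_saddle K g h"
  assumes X: "X \<noteq> {}" "closed X" "convex X"
    and Y: "Y \<noteq> {}" "closed Y" "convex Y"
    and K: "bounded_linear K"
    and g: "proper_on UNIV g" "convex_ereal g" "lsc g"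
    and h: "proper_on UNIV h" "convex_ereal h" "lsc h"
    and f_proper_fst: "\<And>v. v \<in> Y \<Longrightarrow> proper_on X (\<lambda>u. f u v)"
    and f_proper_snd: "\<And>u. u \<in> X \<Longrightarrow> proper_on Y (\<lambda>v. - f u v)"
    and pos: "\<And>i. 0 < \<tau> i" "\<And>i. 0 < \<sigma> i"
    and nonneg: "\<And>i. i \<ge> -1 \<Longrightarrow> 0 \<le> \<alpha> i" "\<And>i. i \<ge> -1 \<Longrightarrow> 0 \<le> \<beta> i"
    and saddle: "saddle_point X Y f xs ys"
    and beta: "\<And>i::nat. onorm K * (\<beta> (int i))\<^sup>2 = 1 / \<tau> i - 1 / \<tau> (i + 1)"
    and alpha: "\<And>i::nat. onorm K * (1 - \<alpha> (int i - 1))\<^sup>2 = 1 / \<sigma> i - 1 / \<sigma> (i + 1)"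
    and tau_lim: "limsup (\<lambda>i. ereal (\<tau> i)) < \<infinity>"
      "ereal (onorm K) * limsup (\<lambda>i. ereal (\<tau> i)) < ereal (1 / 2)"
    and sigma_lim: "limsup (\<lambda>i. ereal (\<sigma> i)) < \<infinity>"
      "ereal (onorm K) * limsup (\<lambda>i. ereal (\<sigma> i)) < ereal (1 / 2)"
    and iter: "iterate_scheme K g h X Y \<tau> \<sigma> \<alpha> \<beta> x y xb yb"
  shows
    "(\<forall>k::nat.
        1 / (2 * \<tau> (k + 1)) * (norm (xs - x (k + 1)))\<^sup>2
        + (1 / (2 * \<sigma> (k + 1)) - (onorm K)\<^sup>2 * \<tau> k / 2) * (norm (ys - y (k + 1)))\<^sup>2
        + (\<Sum>i<k. (1 / (2 * \<tau> i) - onorm K) * (norm (x i - x (i + 1)))\<^sup>2)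
        + (\<Sum>i\<le>k. (1 / (2 * \<sigma> i) - onorm K) * (norm (y i - y (i + 1)))\<^sup>2)
        \<le> 1 / (2 * \<tau> 0) * (norm (xs - x 0))\<^sup>2 + 1 / (2 * \<sigma> 0) * (norm (ys - y 0))\<^sup>2)
     \<and>
     (\<forall>\<tau>b \<sigma>b :: real.
        ereal \<tau>b > limsup (\<lambda>i. ereal (\<tau> i)) \<and> ereal \<sigma>b > limsup (\<lambda>i. ereal (\<sigma> i))
        \<and> onorm K * \<tau>b < 1 / 2 \<and> onorm K * \<sigma>b < 1 / 2 \<longrightarrow>
        (\<exists>N::nat. \<forall>k\<ge>N + 1.
           1 / (2 * \<tau>b) * (norm (xs - x (k + 1)))\<^sup>2
           + (1 / (2 * \<sigma>b) - (onorm K)\<^sup>2 * \<tau>b / 2) * (norm (ys - y (k + 1)))\<^sup>2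
           + (1 / (2 * \<tau>b) - onorm K) * (\<Sum>i=N+1..<k. (norm (x i - x (i + 1)))\<^sup>2)
           + (1 / (2 * \<sigma>b) - onorm K) * (\<Sum>i=N+1..k. (norm (y i - y (i + 1)))\<^sup>2)
           \<le> 1 / (2 * \<tau> 0) * (norm (xs - x 0))\<^sup>2 + 1 / (2 * \<sigma> 0) * (norm (ys - y 0))\<^sup>2
             + (\<Sum>i=0..N. (onorm K - 1 / (2 * \<tau> i)) * (norm (x i - x (i + 1)))\<^sup>2)
             + (\<Sum>i=0..N. (onorm K - 1 / (2 * \<sigma> i)) * (norm (y i - y (i + 1)))\<^sup>2)))
     \<and> (\<lambda>k. norm (x k - x (k + 1))) \<longlonglongrightarrow> 0
     \<and> (\<lambda>k. norm (y k - y (k + 1))) \<longlonglongrightarrow> 0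
     \<and>
     bounded (range (\<lambda>k. (x k, y k)))
     \<and> bounded (range (\<lambda>k. (ergodic_mean x k, ergodic_mean y k)))
     \<and>
     (\<lambda>k. f (ergodic_mean x k) (ergodic_mean y k)) \<longlonglongrightarrow> f xs ys"
proof -
  define G where "G u = real_of_ereal (g u)" for u
  define H where "H v = real_of_ereal (h v)" for v
  define a where "a k = \<alpha> (int k - 1)" for k :: nat
  define b where "b k = \<beta> (int k)" for k :: nat
  have gG: "g u = ereal (G u)" if "u \<in> X" for u
    unfolding G_def
    using finite_if_sections_proper(1)[OF Y(1) X(1) g(1) h(1)] f_proper_fst f_proper_snd that
    unfolding f_def by blast
  have hH: "h v = ereal (H v)" if "v \<in> Y" for v
    unfolding H_def
    using finite_if_sections_proper(2)[OF Y(1) X(1) g(1) h(1)] f_proper_fst f_proper_snd that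
    unfolding f_def by blast
  have f_real: "f u v = ereal (K u \<bullet> v + G u - H v)" if "u \<in> X" "v \<in> Y" for u v
    unfolding f_def bilinear_saddle_def using gG[OF that(1)] hH[OF that(2)] by simp
  have xs: "xs \<in> X" and ys: "ys \<in> Y" using saddle unfolding saddle_point_def by auto
  have saddle_max: "K xs \<bullet> v + G xs - H v \<le> K xs \<bullet> ys + G xs - H ys" if "v \<in> Y" for v
    using saddle that xs ys f_real[OF xs that] f_real[OF xs ys] unfolding saddle_point_def
    by (metis ereal_less_eq(3))
  have saddle_min: "K xs \<bullet> ys + G xs - H ys \<le> K u \<bullet> ys + G u - H ys" if "u \<in> X" for u
    using saddle that xs ys f_real[OF that ys] f_real[OF xs ys] unfolding saddle_point_def
    by (metis ereal_less_eq(3))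
  \<comment> \<open>The saddle inequalities with one variable fixed are affine minorants of \<open>G\<close> and \<open>H\<close>.\<close>
  have lin_G: "bounded_linear (\<lambda>u. - (K u \<bullet> ys))"
    using K by (intro bounded_linear_minus bounded_linear_compose[OF bounded_linear_inner_left])
  have lin_H: "bounded_linear (\<lambda>v. K xs \<bullet> v)" by (rule bounded_linear_inner_right)
  have minorant_G: "(K xs \<bullet> ys + G xs) + - (K u \<bullet> ys) \<le> G u" if "u \<in> X" for u
    using saddle_min[OF that] by simp
  have minorant_H: "(H ys - K xs \<bullet> ys) + K xs \<bullet> v \<le> H v" if "v \<in> Y" for v
    using saddle_max[OF that] by simp
  have start: "x 0 \<in> X" "y 0 \<in> Y" "xb 0 = x 0"
    and y_eq: "y (Suc k) = prox Y (\<lambda>u. ereal (\<sigma> k) * h u) (y k + \<sigma> k *\<^sub>R K (xb k))"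
    and yb_eq: "yb (Suc k) = y (Suc k) + b k *\<^sub>R (y (Suc k) - y k)"
    and x_eq: "x (Suc k) = prox X (\<lambda>u. ereal (\<tau> k) * g u) (x k - \<tau> k *\<^sub>R adjoint K (yb (Suc k)))"
    and xb_Suc: "xb (Suc k) = x (Suc k) + \<alpha> (int k) *\<^sub>R (x (Suc k) - x k)" for k
    using iter unfolding iterate_scheme_def b_def by auto
  have xb_eq: "xb k = x k + a k *\<^sub>R (x k - x (k - 1))" for k
    using start xb_Suc by (cases k) (auto simp: a_def)
  have x_eq': "x (Suc k) = prox X (\<lambda>u. ereal (\<tau> k) * g u) (x k + \<tau> k *\<^sub>R - adjoint K (yb (Suc k)))" for k
    using x_eq[of k] by simp
  note x_prox = prox_step[OF X gG g(2,3) lin_G minorant_G pos(1) x_eq']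
  note y_prox = prox_step[OF Y hH h(2,3) lin_H minorant_H pos(2) y_eq]
  interpret primal_dual_iteration K G H X Y \<tau> \<sigma> a b x y
  proof (rule primal_dual_iteration.intro)
    show "convex_on X G" by (rule convex_on_real_part[OF g(2) X(3) gG])
    show "convex_on Y H" by (rule convex_on_real_part[OF h(2) Y(3) hH])
    show "x k \<in> X" for k using start x_prox(1) by (cases k) auto
    show "y k \<in> Y" for k using start y_prox(1) by (cases k) auto
    show "onorm K * (b k)\<^sup>2 = 1 / \<tau> k - 1 / \<tau> (Suc k)" for k
      using beta[of k] by (simp add: b_def)
    show "onorm K * (1 - a k)\<^sup>2 = 1 / \<sigma> k - 1 / \<sigma> (Suc k)" for k
      using alpha[of k] by (simp add: a_def)
    show "G (x (Suc k)) - G z \<le>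
      1 / (2 * \<tau> k) * ((norm (z - x k))\<^sup>2 - (norm (x k - x (Suc k)))\<^sup>2 - (norm (z - x (Suc k)))\<^sup>2)
      + K (z - x (Suc k)) \<bullet> (y (Suc k) + b k *\<^sub>R (y (Suc k) - y k))" if "z \<in> X" for k z
    proof -
      have "- ((z - x (Suc k)) \<bullet> - adjoint K (yb (Suc k)))
          = K (z - x (Suc k)) \<bullet> (y (Suc k) + b k *\<^sub>R (y (Suc k) - y k))"
        using adjoint_inner[OF K] yb_eq[of k] by simp
      with x_prox(2)[OF _ _ that, of k] show ?thesis by linarith
    qed
    show "H (y (Suc k)) - H w \<le>
      1 / (2 * \<sigma> k) * ((norm (w - y k))\<^sup>2 - (norm (y k - y (Suc k)))\<^sup>2 - (norm (w - y (Suc k)))\<^sup>2)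
      - K (x k + a k *\<^sub>R (x k - x (k - 1))) \<bullet> (w - y (Suc k))" if "w \<in> Y" for k w
      using y_prox(2)[OF _ _ that, of k] xb_eq[of k] by (simp add: inner_commute)
  qed (rule K pos)+
  obtain T where T: "\<And>k. \<tau> k \<le> T" "onorm K * T < 1 / 2"
    using limsup_real_bound[OF incseq_\<tau> tau_lim] by blast
  obtain S where S: "\<And>k. \<sigma> k \<le> S" "onorm K * S < 1 / 2"
    using limsup_real_bound[OF incseq_\<sigma> sigma_lim] by blast
  interpret primal_dual_bounded_steps K G H X Y \<tau> \<sigma> a b x y xs ys T S
    by unfold_locales (use xs ys saddle_max saddle_min T S in \<open>auto simp: \<Phi>_def\<close>)
  have energy: "1 / (2 * \<tau> (k + 1)) * (norm (xs - x (k + 1)))\<^sup>2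
      + (1 / (2 * \<sigma> (k + 1)) - (onorm K)\<^sup>2 * \<tau> k / 2) * (norm (ys - y (k + 1)))\<^sup>2
      + (\<Sum>i<k. (1 / (2 * \<tau> i) - onorm K) * (norm (x i - x (i + 1)))\<^sup>2)
      + (\<Sum>i\<le>k. (1 / (2 * \<sigma> i) - onorm K) * (norm (y i - y (i + 1)))\<^sup>2)
      \<le> 1 / (2 * \<tau> 0) * (norm (xs - x 0))\<^sup>2 + 1 / (2 * \<sigma> 0) * (norm (ys - y 0))\<^sup>2" for k
    using saddle_energy[of k] unfolding lessThan_Suc_atMost unfolding Suc_eq_plus1 .
  have tail: "\<exists>N::nat. \<forall>k\<ge>N + 1.
           1 / (2 * \<tau>b) * (norm (xs - x (k + 1)))\<^sup>2
           + (1 / (2 * \<sigma>b) - (onorm K)\<^sup>2 * \<tau>b / 2) * (norm (ys - y (k + 1)))\<^sup>2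
           + (1 / (2 * \<tau>b) - onorm K) * (\<Sum>i=N+1..<k. (norm (x i - x (i + 1)))\<^sup>2)
           + (1 / (2 * \<sigma>b) - onorm K) * (\<Sum>i=N+1..k. (norm (y i - y (i + 1)))\<^sup>2)
           \<le> 1 / (2 * \<tau> 0) * (norm (xs - x 0))\<^sup>2 + 1 / (2 * \<sigma> 0) * (norm (ys - y 0))\<^sup>2
             + (\<Sum>i=0..N. (onorm K - 1 / (2 * \<tau> i)) * (norm (x i - x (i + 1)))\<^sup>2)
             + (\<Sum>i=0..N. (onorm K - 1 / (2 * \<sigma> i)) * (norm (y i - y (i + 1)))\<^sup>2)"
    if "ereal \<tau>b > limsup (\<lambda>i. ereal (\<tau> i))" "ereal \<sigma>b > limsup (\<lambda>i. ereal (\<sigma> i))" for \<tau>b \<sigma>b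
  proof -
    have "\<tau> i \<le> \<tau>b" "\<sigma> i \<le> \<sigma>b" for i
      using le_less_trans[OF incseq_le_limsup[OF incseq_\<tau>] that(1), of i]
        le_less_trans[OF incseq_le_limsup[OF incseq_\<sigma>] that(2), of i] by simp_all
    then show ?thesis
      \<comment> \<open>Monotone step sizes never exceed the bounds, so already \<open>N = 0\<close> works.\<close>
      by (intro exI[of _ 0] allI impI saddle_energy_tail[of \<tau>b \<sigma>b 0, unfolded Suc_eq_plus1]) simp_all
  qed
  have "ergodic_mean x k \<in> X" "ergodic_mean y k \<in> Y" for k
    using X(3) Y(3) x_in y_in by (auto intro: ergodic_mean_in_convex)
  then have f_means: "f (ergodic_mean x k) (ergodic_mean y k)
      = ereal (\<Phi> (ergodic_mean x k) (ergodic_mean y k))" for k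
    unfolding \<Phi>_def by (intro f_real)
  have pair: "bounded (range (\<lambda>k. (u k, v k)))" if "bounded (range u)" "bounded (range v)"
    for u :: "nat \<Rightarrow> 'a" and v :: "nat \<Rightarrow> 'b"
    by (rule bounded_subset[OF bounded_Times[OF that]]) auto
  have value_limit: "(\<lambda>k. f (ergodic_mean x k) (ergodic_mean y k)) \<longlonglongrightarrow> f xs ys"
    unfolding f_means f_real[OF xs ys] \<Phi>_def[symmetric] lim_ereal by (rule ergodic_value_tendsto)
  show ?thesis
    by (intro conjI allI impI)
      (rule energy tail value_limit increments_tendsto_0[unfolded Suc_eq_plus1]
        pair[OF iterates_bounded] pair[OF ergodic_means_bounded] | elim conjE, assumption)+
qed

end
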